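(* Let $G = (A, B, E)$ be a finite bigraph without isolated vertices. For each vertex $v \in A \sqcup B$ let $d_v$ denote the degree of $v$ in $G$. Let $\lambda, \mu > 0$ be real. Then \[ P_G(\lambda,\mu) \le \prod_{\substack{uv \in E \\ u \in A,\ v \in B}} \left((1+\lambda)^{d_v} + (1+\mu)^{d_u} - 1\right)^{1/(d_u d_v)}. \] Equality holds if and only if $G$ is a disjoint union of complete bipartite graphs.
   Context: A bigraph $G = (A,B,E)$ is a bipartite graph with a specified vertex bipartition $V(G) = A \sqcup B$ and edge set $E \subseteq A \times B$; graphs are finite and simple. An isolated vertex is a vertex of degree $0$. $\mathcal{I}(G)$ denotes the set of independent sets of $G$ (including the empty set), and the two-variable independent set polynomial of the bigraph $G$ is $P_G(\lambda,\mu) = \sum_{I \in \mathcal{I}(G)} \lambda^{|I \cap A|} \mu^{|I \cap B|}$. In a disjoint union of complete bipartite graphs, the components may be $K_{a,b}$ with different values of $a,b \ge 1$, where $K_{a,b}$ is the complete bipartite graph with parts of sizes $a$ and $b$. *)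

theory Defs
  imports Complex_Main "HOL-Library.Disjoint_Sets"
begin

text \<open>
  A bigraph is given by its two vertex classes and its edge set. Both classes live in one
  vertex type, and the vertex set is their disjoint union. An edge is the pair of its end
  in the left class and its end in the right class.
\<close>

definition bigraph :: "'a set \<Rightarrow> 'a set \<Rightarrow> ('a \<times> 'a) set \<Rightarrow> bool" where
  "bigraph A B E \<longleftrightarrow> finite A \<and> finite B \<and> A \<inter> B = {} \<and> E \<subseteq> A \<times> B"

definition degree :: "('a \<times> 'a) set \<Rightarrow> 'a \<Rightarrow> nat" where
  "degree E v = card {w. (v, w) \<in> E \<or> (w, v) \<in> E}"

definition isolated :: "('a \<times> 'a) set \<Rightarrow> 'a \<Rightarrow> bool" where
  "isolated E v \<longleftrightarrow> degree E v = 0"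

definition independent_sets :: "'a set \<Rightarrow> 'a set \<Rightarrow> ('a \<times> 'a) set \<Rightarrow> 'a set set" where
  "independent_sets A B E = {I. I \<subseteq> A \<union> B \<and> (\<forall>u\<in>I. \<forall>v\<in>I. (u, v) \<notin> E)}"

definition indep_poly ::
    "'a set \<Rightarrow> 'a set \<Rightarrow> ('a \<times> 'a) set \<Rightarrow> real \<Rightarrow> real \<Rightarrow> real" where
  "indep_poly A B E x y = (\<Sum>I\<in>independent_sets A B E. x ^ card (I \<inter> A) * y ^ card (I \<inter> B))"

definition complete_bipartite :: "'a set \<Rightarrow> 'a set \<Rightarrow> ('a \<times> 'a) set \<Rightarrow> bool" where
  "complete_bipartite A B E \<longleftrightarrow> bigraph A B E \<and> A \<noteq> {} \<and> B \<noteq> {} \<and> E = A \<times> B"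

text \<open>
  The number \<open>n\<close> of components may be 0, so the graph without vertices counts as a (empty)
  disjoint union.
\<close>

definition disjoint_union_complete_bipartite ::
    "'a set \<Rightarrow> 'a set \<Rightarrow> ('a \<times> 'a) set \<Rightarrow> bool" where
  "disjoint_union_complete_bipartite A B E \<longleftrightarrow>
     (\<exists>(n::nat) X Y F.
        (\<forall>i<n. complete_bipartite (X i) (Y i) (F i)) \<and>
        disjoint_family_on (\<lambda>i. X i \<union> Y i) {..<n} \<and>
        A = (\<Union>i<n. X i) \<and> B = (\<Union>i<n. Y i) \<and> E = (\<Union>i<n. F i))"

end

theory Submission
  imports Defs
begin

text \<open>
  The bound is proved by induction for all bigraphs, where an isolated vertex contributes
  its own polynomial \<open>1 + x\<close> or \<open>1 + y\<close>. Without edges the two sides agree.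

  Otherwise choose \<open>w \<in> A\<close> of maximum degree \<open>n\<close> among \<open>A\<close>, with neighbourhood \<open>V\<close>. Splitting the independent sets
  by whether they contain \<open>w\<close> gives \<open>P(G) = P(G - w) + x P(G - w - V)\<close>
  (\<open>indep_poly_remove_left_vertex\<close>), and the induction hypothesis bounds both terms. Deleting \<open>V\<close> lowers
  degrees in \<open>A\<close>, so the bound for \<open>G - w - V\<close> has altered factors at edges that do not meet \<open>V\<close>. They are
  brought back to the factors of \<open>G\<close> at the price of \<open>(1 + x) powr (1 / deg u)\<close> for each deleted edge \<open>uv\<close>
  with \<open>u \<noteq> w\<close> (\<open>degree_bound_remove_closed_neighbourhood\<close>). All edges that do not meet \<open>V\<close> then cancel,
  and it remains to show
  \<open>x (\<Prod>v\<in>V. q v) + (\<Prod>v\<in>V. r v) \<le> (\<Prod>v\<in>V. M v)\<close>, where \<open>q\<close>, \<open>r\<close>, \<open>M\<close> collect the factors at \<open>v\<close> for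
  the three graphs. Since \<open>card V = n\<close>, Hoelder's inequality reduces this to \<open>x q^n + r^n \<le> M^n\<close> at each
  \<open>v\<close> (\<open>star_inequality\<close>), and a second use of Hoelder over the neighbours \<open>u \<noteq> w\<close> of \<open>v\<close> reduces it to an
  inequality in the degrees of \<open>u\<close>, \<open>v\<close>, \<open>w\<close> (\<open>two_degree_inequality\<close>). With \<open>p = n / deg u \<ge> 1\<close> that
  inequality follows from a log-convexity property of \<open>z \<mapsto> (z + t)^p - z^p\<close>
  (\<open>power_increment_log_convex\<close>).

  Some comparison is strict unless every left vertex that has a neighbour in \<open>V\<close> has degree \<open>n\<close> and all its
  neighbours in \<open>V\<close>, so that its neighbourhood is exactly \<open>V\<close>. Hence in the case of equality the component of \<open>w\<close> is
  complete bipartite, and by induction any two neighbourhoods of left vertices are equal or disjoint.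
  Conversely both sides are multiplicative over components and agree on \<open>K_{a,b}\<close>.
\<close>

section \<open>Hoelder's inequality with its case of equality\<close>

text \<open>
  Sum the inequalities \<open>ln z \<le> z - 1\<close> at \<open>z = u i / m\<close>, where \<open>m\<close> is the weighted mean. The right sides
  add up to 0, and equality in each forces \<open>u i = m\<close> for all \<open>i\<close>.
\<close>

lemma weighted_am_gm:
  fixes u w :: "'b \<Rightarrow> real"
  assumes "finite S" and "\<And>i. i \<in> S \<Longrightarrow> 0 < u i" and "\<And>i. i \<in> S \<Longrightarrow> 0 < w i"
    and "sum w S = 1"
  shows "(\<Prod>i\<in>S. u i powr w i) \<le> (\<Sum>i\<in>S. w i * u i)"
    and "i \<in> S \<Longrightarrow> j \<in> S \<Longrightarrow> u i \<noteq> u j \<Longrightarrow> (\<Prod>i\<in>S. u i powr w i) < (\<Sum>i\<in>S. w i * u i)"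
proof -
  have ne: "u i \<noteq> 0" if "i \<in> S" for i using assms(2)[OF that] by simp
  define m where "m = (\<Sum>i\<in>S. w i * u i)"
  have "S \<noteq> {}" using assms(4) by auto
  then have m: "m > 0" unfolding m_def using assms by (intro sum_pos) auto
  have ln_m: "ln (\<Prod>i\<in>S. u i powr w i) - ln m = (\<Sum>i\<in>S. w i * ln (u i / m))"
  proof -
    have "ln (\<Prod>i\<in>S. u i powr w i) = (\<Sum>i\<in>S. w i * ln (u i))"
      using ne by (subst ln_prod[OF assms(1)]) auto
    moreover have "(\<Sum>i\<in>S. w i * ln (u i / m)) = (\<Sum>i\<in>S. w i * ln (u i)) - (\<Sum>i\<in>S. w i) * ln m"
      unfolding sum_distrib_right sum_subtractf[symmetric]
      using ne m by (intro sum.cong) (auto simp: ln_div algebra_simps)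
    ultimately show ?thesis using assms(4) by simp
  qed
  have zero: "(\<Sum>i\<in>S. w i * (u i / m - 1)) = 0"
  proof -
    have "(\<Sum>i\<in>S. w i * (u i / m - 1)) = (\<Sum>i\<in>S. w i * u i) / m - sum w S"
      by (simp add: sum_divide_distrib right_diff_distrib sum_subtractf)
    then show ?thesis using assms(4) m m_def by simp
  qed
  have step: "w i * ln (u i / m) \<le> w i * (u i / m - 1)" if "i \<in> S" for i
    using assms(2,3)[OF that] m by (intro mult_left_mono ln_le_minus_one) auto
  have pos: "(\<Prod>i\<in>S. u i powr w i) > 0" using ne by (intro prod_pos) auto
  have "ln (\<Prod>i\<in>S. u i powr w i) - ln m \<le> 0"
    unfolding ln_m zero[symmetric] by (intro sum_mono step)
  then show "(\<Prod>i\<in>S. u i powr w i) \<le> (\<Sum>i\<in>S. w i * u i)"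
    using pos m by (simp add: m_def)
  show "(\<Prod>i\<in>S. u i powr w i) < (\<Sum>i\<in>S. w i * u i)" if ij: "i \<in> S" "j \<in> S" "u i \<noteq> u j"
  proof -
    obtain k where k: "k \<in> S" "u k \<noteq> m" using ij by metis
    have "ln (u k / m) \<noteq> u k / m - 1"
      using ln_eq_minus_one[of "u k / m"] k assms(2)[OF k(1)] m by auto
    then have "w k * ln (u k / m) < w k * (u k / m - 1)"
      using step[OF k(1)] assms(3)[OF k(1)] by auto
    then have "ln (\<Prod>i\<in>S. u i powr w i) - ln m < 0"
      unfolding ln_m zero[symmetric] using k(1) assms(1) step by (intro sum_strict_mono_ex1) auto
    then show ?thesis using pos m by (simp add: m_def)
  qed
qed

text \<open>
  After division by the right-hand side the claim is the sum of two inequalities between weighted means,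
  for \<open>a i / (a i + b i)\<close> and for the complementary fractions, and the arithmetic means add up to 1.
  The condition for strictness says that these fractions are not all equal.
\<close>

lemma holder_prod:
  fixes a b w :: "'b \<Rightarrow> real"
  assumes "finite S" and "\<And>i. i \<in> S \<Longrightarrow> 0 < a i" and "\<And>i. i \<in> S \<Longrightarrow> 0 < b i"
    and "\<And>i. i \<in> S \<Longrightarrow> 0 < w i" and "sum w S = 1"
  shows "(\<Prod>i\<in>S. a i powr w i) + (\<Prod>i\<in>S. b i powr w i) \<le> (\<Prod>i\<in>S. (a i + b i) powr w i)"
    and "i \<in> S \<Longrightarrow> j \<in> S \<Longrightarrow> a i * b j \<noteq> a j * b i \<Longrightarrow>
      (\<Prod>i\<in>S. a i powr w i) + (\<Prod>i\<in>S. b i powr w i) < (\<Prod>i\<in>S. (a i + b i) powr w i)"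
proof -
  define p where "p = (\<lambda>i. a i / (a i + b i))"
  define q where "q = (\<lambda>i. b i / (a i + b i))"
  define M where "M = (\<Prod>i\<in>S. (a i + b i) powr w i)"
  have pq: "p i > 0" "q i > 0" "p i + q i = 1" "a i = p i * (a i + b i)" "b i = q i * (a i + b i)"
    "a i + b i > 0" if "i \<in> S" for i
  proof -
    have "a i + b i > 0" using assms(2,3)[OF that] by simp
    then show "p i > 0" "q i > 0" "p i + q i = 1" "a i = p i * (a i + b i)" "b i = q i * (a i + b i)"
      "a i + b i > 0"
      using assms(2,3)[OF that] by (simp_all add: p_def q_def add_divide_distrib[symmetric])
  qed
  have M: "M > 0" unfolding M_def using pq(6) by (intro prod_pos) (auto simp: less_imp_neq[symmetric])
  have "(\<Prod>i\<in>S. a i powr w i) = (\<Prod>i\<in>S. p i powr w i) * M"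
    unfolding M_def prod.distrib[symmetric]
    using pq by (intro prod.cong refl) (metis less_imp_le powr_mult)
  moreover have "(\<Prod>i\<in>S. b i powr w i) = (\<Prod>i\<in>S. q i powr w i) * M"
    unfolding M_def prod.distrib[symmetric]
    using pq by (intro prod.cong refl) (metis less_imp_le powr_mult)
  ultimately have lhs: "(\<Prod>i\<in>S. a i powr w i) + (\<Prod>i\<in>S. b i powr w i)
      = ((\<Prod>i\<in>S. p i powr w i) + (\<Prod>i\<in>S. q i powr w i)) * M"
    by (simp add: algebra_simps)
  have "(\<Sum>i\<in>S. w i * p i) + (\<Sum>i\<in>S. w i * q i) = sum w S"
    unfolding sum.distrib[symmetric] distrib_left[symmetric] using pq(3) by (intro sum.cong) auto
  then have one: "(\<Sum>i\<in>S. w i * p i) + (\<Sum>i\<in>S. w i * q i) = 1" using assms(5) by simp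
  have "(\<Prod>i\<in>S. p i powr w i) \<le> (\<Sum>i\<in>S. w i * p i)"
    using assms pq by (intro weighted_am_gm) auto
  moreover have q_le: "(\<Prod>i\<in>S. q i powr w i) \<le> (\<Sum>i\<in>S. w i * q i)"
    using assms pq by (intro weighted_am_gm) auto
  ultimately have "(\<Prod>i\<in>S. p i powr w i) + (\<Prod>i\<in>S. q i powr w i) \<le> 1"
    using one by linarith
  then have "((\<Prod>i\<in>S. p i powr w i) + (\<Prod>i\<in>S. q i powr w i)) * M \<le> 1 * M"
    using M by (intro mult_right_mono) auto
  then show "(\<Prod>i\<in>S. a i powr w i) + (\<Prod>i\<in>S. b i powr w i) \<le> (\<Prod>i\<in>S. (a i + b i) powr w i)"
    unfolding lhs by (simp add: M_def)
  show "(\<Prod>i\<in>S. a i powr w i) + (\<Prod>i\<in>S. b i powr w i) < (\<Prod>i\<in>S. (a i + b i) powr w i)"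
    if ij: "i \<in> S" "j \<in> S" "a i * b j \<noteq> a j * b i"
  proof -
    have "p i \<noteq> p j"
      using pq(6)[OF ij(1)] pq(6)[OF ij(2)] ij(3) by (auto simp: p_def field_simps)
    then have "(\<Prod>i\<in>S. p i powr w i) < (\<Sum>i\<in>S. w i * p i)"
      using assms pq ij by (intro weighted_am_gm(2)[of _ _ _ i j]) auto
    then have "(\<Prod>i\<in>S. p i powr w i) + (\<Prod>i\<in>S. q i powr w i) < 1"
      using one q_le by linarith
    then have "((\<Prod>i\<in>S. p i powr w i) + (\<Prod>i\<in>S. q i powr w i)) * M < 1 * M"
      using M by (intro mult_strict_right_mono) auto
    then show ?thesis unfolding lhs by (simp add: M_def)
  qed
qed

lemma holder_two:
  fixes a b c d \<theta> :: real
  assumes "0 < a" "0 < b" "0 < c" "0 < d" "0 < \<theta>" "\<theta> < 1"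
  shows "a powr \<theta> * c powr (1 - \<theta>) + b powr \<theta> * d powr (1 - \<theta>)
      \<le> (a + b) powr \<theta> * (c + d) powr (1 - \<theta>)"
    and "a * d \<noteq> b * c \<Longrightarrow> a powr \<theta> * c powr (1 - \<theta>) + b powr \<theta> * d powr (1 - \<theta>)
      < (a + b) powr \<theta> * (c + d) powr (1 - \<theta>)"
  using holder_prod(1)[where S = UNIV and a = "\<lambda>i. if i then a else c"
      and b = "\<lambda>i. if i then b else d" and w = "\<lambda>i. if i then \<theta> else 1 - \<theta>"]
    holder_prod(2)[where S = UNIV and a = "\<lambda>i. if i then a else c"
      and b = "\<lambda>i. if i then b else d" and w = "\<lambda>i. if i then \<theta> else 1 - \<theta>"
      and i = True and j = False] assms
  by (auto simp: UNIV_bool mult.commute)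

lemma prod_mono_eq:
  fixes f g :: "'b \<Rightarrow> real"
  assumes "finite S" and "\<And>i. i \<in> S \<Longrightarrow> 0 < f i \<and> f i \<le> g i" and "prod f S = prod g S" and "i \<in> S"
  shows "f i = g i"
proof (rule ccontr)
  assume "f i \<noteq> g i"
  then have "f i < g i" using assms(2,4) by (meson order_le_less)
  moreover have "prod g S > 0" using assms(2) by (intro prod_pos) (meson less_le_trans)
  ultimately have "prod f S < prod g S"
    using assms by (intro prod_mono_strict[of i]) (auto simp: less_imp_le intro: less_le_trans)
  then show False using assms(3) by simp
qed

text \<open>
  For \<open>p > 1\<close> the function \<open>s \<mapsto> (exp s + t)^p - exp (s p)\<close> is log-convex: it is the integral over
  \<open>h \<in> [0, t]\<close> of \<open>p (exp s + h)^(p - 1)\<close>, each of which is log-convex. The proof carries this out by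
  differentiating the difference \<open>Q\<close> of the two sides in \<open>t\<close>. The derivative of the product of powers
  is at least the product of the powers of the derivatives, by the weighted inequality of the means, and
  that exceeds the derivative of the left side by Hoelder's inequality.
\<close>

lemma power_increment_log_convex:
  fixes p r s t \<theta> :: real
  assumes "1 < p" "0 < r" "0 < s" "r \<noteq> s" "0 < t" "0 < \<theta>" "\<theta> < 1"
  shows "(r powr \<theta> * s powr (1 - \<theta>) + t) powr p - (r powr \<theta> * s powr (1 - \<theta>)) powr p
    < ((r + t) powr p - r powr p) powr \<theta> * ((s + t) powr p - s powr p) powr (1 - \<theta>)"
proof -
  define c where "c = r powr \<theta> * s powr (1 - \<theta>)"
  define F where "F = (\<lambda>z h::real. (z + h) powr p - z powr p)"
  define F' where "F' = (\<lambda>z h::real. p * (z + h) powr (p - 1))"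
  define Q where "Q = (\<lambda>h. F r h powr \<theta> * F s h powr (1 - \<theta>) - F c h)"
  have c: "c > 0" using assms by (simp add: c_def)
  have Fpos: "F z h > 0" if "z > 0" "h > 0" for z h
    using that assms powr_less_mono2[of p z "z + h"] by (simp add: F_def)
  have F'pos: "F' z h > 0" if "z > 0" "h > 0" for z h
    using that assms by (simp add: F'_def)
  have DF: "(F z has_real_derivative F' z h) (at h)" if "z > 0" "h > 0" for z h
    unfolding F_def F'_def using that by (auto intro!: derivative_eq_intros)
  have contF: "continuous_on {0..t} (F z)" if "z > 0" for z
    unfolding F_def using that by (intro continuous_intros) auto
  have Fnn: "F z h \<ge> 0" if "z > 0" "h \<in> {0..t}" for z h
    using that Fpos[of z h] by (cases "h = 0") (auto simp: F_def)
  have "Q 0 < Q t"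
  proof (rule DERIV_pos_imp_increasing_open[OF assms(5)])
    show "continuous_on {0..t} Q"
      unfolding Q_def using assms c Fnn
      by (intro continuous_intros contF continuous_on_powr') auto
    fix h assume h: "0 < h" "h < t"
    define f g where "f = F r h" and "g = F s h"
    define f' g' where "f' = F' r h" and "g' = F' s h"
    have pos: "f > 0" "g > 0" "f' > 0" "g' > 0"
      using Fpos F'pos assms h by (auto simp: f_def g_def f'_def g'_def)
    have D: "(Q has_real_derivative
        f powr \<theta> * g powr (1 - \<theta>) * (\<theta> * (f' / f) + (1 - \<theta>) * (g' / g)) - F' c h) (at h)"
      unfolding Q_def
      apply (rule derivative_eq_intros DF refl has_real_derivative_powr | use assms h c pos Fpos in \<open>simp; fail\<close>)+
      using pos by (simp add: f_def[symmetric] g_def[symmetric] f'_def[symmetric] g'_def[symmetric] powr_diff powr_minus field_simps)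
    have "F' c h < f' powr \<theta> * g' powr (1 - \<theta>)"
    proof -
      have "c + h < (r + h) powr \<theta> * (s + h) powr (1 - \<theta>)"
        using holder_two(2)[of r h s h \<theta>] assms h
        by (simp add: c_def powr_add[symmetric])
      then have "(c + h) powr (p - 1) < ((r + h) powr \<theta> * (s + h) powr (1 - \<theta>)) powr (p - 1)"
        using assms c h by (intro powr_less_mono2) auto
      also have "\<dots> = ((r + h) powr (p - 1)) powr \<theta> * ((s + h) powr (p - 1)) powr (1 - \<theta>)"
        by (simp add: powr_mult powr_powr mult.commute)
      finally have "p * (c + h) powr (p - 1)
          < p * (((r + h) powr (p - 1)) powr \<theta> * ((s + h) powr (p - 1)) powr (1 - \<theta>))"
        using assms by simp
      also have "\<dots> = f' powr \<theta> * g' powr (1 - \<theta>)"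
        using assms h powr_add[of p \<theta> "1 - \<theta>"] by (simp add: f'_def g'_def F'_def powr_mult)
      finally show ?thesis by (simp add: F'_def)
    qed
    also have "f' powr \<theta> * g' powr (1 - \<theta>)
        = f powr \<theta> * g powr (1 - \<theta>) * ((f' / f) powr \<theta> * (g' / g) powr (1 - \<theta>))"
      using pos by (simp add: powr_divide)
    also have "\<dots> \<le> f powr \<theta> * g powr (1 - \<theta>) * (\<theta> * (f' / f) + (1 - \<theta>) * (g' / g))"
      using weighted_am_gm(1)[of UNIV "\<lambda>i. if i then f' / f else g' / g" "\<lambda>i. if i then \<theta> else 1 - \<theta>"]
        pos assms by (intro mult_left_mono) (auto simp: UNIV_bool mult.commute add.commute)
    finally show "\<exists>d. (Q has_real_derivative d) (at h) \<and> d > 0"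
      using D by (intro exI[of _ "_ - F' c h"] conjI) auto
  qed
  moreover have "Q 0 = 0" using assms by (simp add: Q_def F_def)
  ultimately show ?thesis by (simp add: Q_def F_def c_def)
qed

section \<open>Inequalities between edge factors\<close>

text \<open>
  The arguments \<open>a\<close> and \<open>b\<close> are degrees: a left vertex has degree \<open>a\<close>, so the right side has
  \<open>a\<close> vertices, and dually for \<open>b\<close>.
\<close>

definition biclique_poly :: "real \<Rightarrow> real \<Rightarrow> nat \<Rightarrow> nat \<Rightarrow> real" where
  "biclique_poly x y a b = (1 + x) ^ b + (1 + y) ^ a - 1"

definition edge_factor :: "real \<Rightarrow> real \<Rightarrow> nat \<Rightarrow> nat \<Rightarrow> real" where
  "edge_factor x y a b = biclique_poly x y a b powr (1 / (real a * real b))"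

lemma biclique_poly_pos:
  assumes "0 < x" "0 < y"
  shows "0 < biclique_poly x y a b"
proof -
  have "(1 + x) ^ b \<ge> 1" "(1 + y) ^ a \<ge> 1" using assms by (auto intro: one_le_power)
  then show ?thesis unfolding biclique_poly_def by linarith
qed

lemma edge_factor_pos:
  assumes "0 < x" "0 < y"
  shows "0 < edge_factor x y a b"
  using biclique_poly_pos[OF assms, of a b] by (simp add: edge_factor_def)

text \<open>
  Adding back edges at a left vertex, from degree \<open>m\<close> to \<open>d\<close>. The exponent is such that a vertex with \<open>m\<close>
  remaining edges pays \<open>(1 + x) powr ((d - m) / d)\<close> in total, hence \<open>(1 + x) powr (1 / d)\<close> for each
  edge added. This is Hoelder's inequality with \<open>\<theta> = m / d\<close> for the pairs
  \<open>((1 + x)^e - 1, (1 + y)^d)\<close> and \<open>((1 + x)^e - 1, 1)\<close>.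
\<close>

lemma edge_factor_less_increase_left:
  fixes x y :: real
  assumes "0 < x" "0 < y" "0 < m" "m < d" "0 < e"
  shows "edge_factor x y m e < (1 + x) powr ((1 - m / d) / m) * edge_factor x y d e"
proof -
  define \<theta> where "\<theta> = real m / real d"
  have \<theta>: "0 < \<theta>" "\<theta> < 1" using assms by (auto simp: \<theta>_def)
  have big: "(1 + x) ^ e > 1" "(1 + y) ^ d > 1" using assms by (auto intro: one_less_power)
  have "((1 + y) ^ d) powr \<theta> = (1 + y) ^ m"
    using assms by (simp add: powr_realpow[symmetric] powr_powr \<theta>_def)
  moreover have "((1 + x) ^ e - 1) powr \<theta> * ((1 + x) ^ e - 1) powr (1 - \<theta>) = (1 + x) ^ e - 1"
    using big by (simp add: powr_add[symmetric])
  moreover have ne: "((1 + x) ^ e - 1) * 1 \<noteq> (1 + y) ^ d * ((1 + x) ^ e - 1)"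
    using big by simp
  ultimately have "biclique_poly x y m e < biclique_poly x y d e powr \<theta> * ((1 + x) ^ e) powr (1 - \<theta>)"
    using holder_two(2)[of "(1 + x) ^ e - 1" "(1 + y) ^ d" "(1 + x) ^ e - 1" 1 \<theta>, OF _ _ _ _ \<theta> ne]
      big by (simp add: biclique_poly_def algebra_simps)
  then have "edge_factor x y m e
      < (biclique_poly x y d e powr \<theta> * ((1 + x) ^ e) powr (1 - \<theta>)) powr (1 / (real m * real e))"
    unfolding edge_factor_def using assms biclique_poly_pos[of x y m e]
    by (intro powr_less_mono2) auto
  also have "\<dots> = (1 + x) powr ((1 - m / d) / m) * edge_factor x y d e"
  proof -
    have "(1 - \<theta>) * (1 / (real m * real e)) * real e = (1 - m / d) / m"
      "\<theta> * (1 / (real m * real e)) = 1 / (real d * real e)"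
      using assms by (simp_all add: \<theta>_def)
    then show ?thesis
      using assms by (simp add: edge_factor_def powr_mult powr_powr mult_ac flip: powr_realpow)
  qed
  finally show ?thesis .
qed

text \<open>
  Here \<open>n\<close> is the degree of the vertex removed, \<open>Suc m\<close> the degree of a neighbour of it, and \<open>a\<close> the degree of
  another neighbour of that. Put \<open>p = n / a\<close>, \<open>\<theta> = 1 / Suc m\<close>, \<open>X = (1 + x)^m\<close>,
  \<open>Z = (1 + x)^(Suc m)\<close> and \<open>t = (1 + y)^a - 1\<close>, so that \<open>(1 + t)^p = (1 + y)^n\<close>. The right side is
  \<open>(Z + ((1 + t)^p - 1))^\<theta> (Z^p + ((Z + t)^p - Z^p))^(1 - \<theta>)\<close>. By Hoelder it is at least
  \<open>(1 + x) X^p\<close>, which comes from the first summands, plus a term that the log-convexity lemma bounds from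
  below by \<open>(X + t)^p - X^p\<close>, since \<open>X = 1^\<theta> Z^(1 - \<theta>)\<close>.
\<close>

lemma two_degree_inequality:
  fixes x y :: real
  assumes "0 < x" "0 < y" "0 < a" "a < n" "0 < m"
  shows "x * (1 + x) powr (real n / a * m) + biclique_poly x y a m powr (real n / a)
    < biclique_poly x y n (Suc m) powr (1 / Suc m)
      * biclique_poly x y a (Suc m) powr (real n / a * (m / Suc m))"
proof -
  define p where "p = real n / a"
  define \<theta> where "\<theta> = 1 / real (Suc m)"
  define X where "X = (1 + x) ^ m"
  define Z where "Z = (1 + x) ^ Suc m"
  define t where "t = (1 + y) ^ a - 1"
  have p: "p > 1" using assms by (simp add: p_def)
  have \<theta>: "0 < \<theta>" "\<theta> < 1" and \<theta>m: "1 - \<theta> = m / Suc m" using assms by (auto simp: \<theta>_def field_simps)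
  have Z: "Z > 1" unfolding Z_def using assms by (intro one_less_power) auto
  have t: "t > 0" unfolding t_def using assms by (simp add: one_less_power)
  have ZX: "Z powr (1 - \<theta>) = X"
    using assms unfolding Z_def X_def \<theta>m by (simp add: powr_realpow[symmetric] powr_powr del: power_Suc)
  have Z\<theta>: "Z powr \<theta> = 1 + x"
    using assms unfolding Z_def \<theta>_def by (simp add: powr_realpow[symmetric] powr_powr del: power_Suc)
  have Xp: "X powr p = (1 + x) powr (p * m)"
    using assms unfolding X_def by (simp add: powr_realpow[symmetric] powr_powr mult.commute)
  have tp: "(1 + t) powr p = (1 + y) ^ n"
    using assms unfolding t_def p_def by (simp add: powr_realpow[symmetric] powr_powr)
  have incr: "(X + t) powr p - X powr p
      < ((1 + t) powr p - 1) powr \<theta> * ((Z + t) powr p - Z powr p) powr (1 - \<theta>)"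
    using power_increment_log_convex[of p 1 Z t \<theta>] p Z t \<theta> by (simp add: ZX)
  have "1 powr p < (1 + t) powr p" "Z powr p < (Z + t) powr p"
    using p t Z by (auto intro!: powr_less_mono2)
  then have "Z powr \<theta> * (Z powr p) powr (1 - \<theta>)
      + ((1 + t) powr p - 1) powr \<theta> * ((Z + t) powr p - Z powr p) powr (1 - \<theta>)
      \<le> (Z + ((1 + t) powr p - 1)) powr \<theta> * ((Z + t) powr p) powr (1 - \<theta>)"
    using holder_two(1)[of Z "(1 + t) powr p - 1" "Z powr p" "(Z + t) powr p - Z powr p" \<theta>] Z \<theta>
    by simp
  moreover have "(Z powr p) powr (1 - \<theta>) = X powr p"
    using ZX by (simp add: powr_powr mult.commute flip: ZX)
  ultimately have "(1 + x) * X powr p + ((X + t) powr p - X powr p)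
      < (Z + ((1 + t) powr p - 1)) powr \<theta> * ((Z + t) powr p) powr (1 - \<theta>)"
    using incr Z\<theta> by simp
  then have "x * X powr p + (X + t) powr p
      < (Z + ((1 + t) powr p - 1)) powr \<theta> * ((Z + t) powr p) powr (1 - \<theta>)"
    by (simp add: algebra_simps)
  moreover have "biclique_poly x y a m = X + t" "biclique_poly x y a (Suc m) = Z + t"
    "biclique_poly x y n (Suc m) = Z + ((1 + t) powr p - 1)"
    unfolding tp by (simp_all add: biclique_poly_def X_def Z_def t_def)
  ultimately show ?thesis
    unfolding Xp p_def[symmetric] \<theta>m[symmetric] by (simp add: powr_powr \<theta>_def)
qed

text \<open>
  For \<open>a = n\<close> both sides equal \<open>biclique_poly x y n (Suc m)\<close>: this is the identity
  that makes complete bipartite graphs extremal.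
\<close>

lemma two_degree_inequality_le:
  fixes x y :: real
  assumes "0 < x" "0 < y" "0 < a" "a \<le> n" "0 < m"
  shows "x * (1 + x) powr (real n / a * m) + biclique_poly x y a m powr (real n / a)
    \<le> biclique_poly x y n (Suc m) powr (1 / Suc m)
      * biclique_poly x y a (Suc m) powr (real n / a * (m / Suc m))"
proof (cases "a = n")
  case True
  have "biclique_poly x y n (Suc m) powr (1 / Suc m) * biclique_poly x y n (Suc m) powr (m / Suc m)
      = biclique_poly x y n (Suc m) powr ((1 + m) / Suc m)"
    by (simp add: powr_add[symmetric] add_divide_distrib[symmetric])
  also have "\<dots> = biclique_poly x y n (Suc m)" 
    using biclique_poly_pos[OF assms(1,2), of n "Suc m"] by simp
  finally show ?thesis using True assms biclique_poly_pos[OF assms(1,2), of n m]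
    by (simp add: powr_realpow) (simp add: biclique_poly_def algebra_simps)
next
  case False
  then show ?thesis using two_degree_inequality[of x y a n m] assms by simp
qed

text \<open>
  Hoelder's inequality over a set of size \<open>n\<close> turns an inequality between \<open>n\<close>-th powers at each index into one
  between the products.
\<close>

lemma holder_equal_weights:
  fixes q r M :: "'b \<Rightarrow> real"
  assumes "finite S" "card S = n" "0 < n" "0 < c"
    and "\<And>i. i \<in> S \<Longrightarrow> 0 < q i" "\<And>i. i \<in> S \<Longrightarrow> 0 < r i" "\<And>i. i \<in> S \<Longrightarrow> 0 < M i"
    and le: "\<And>i. i \<in> S \<Longrightarrow> c * q i ^ n + r i ^ n \<le> M i ^ n"
  shows "c * (\<Prod>i\<in>S. q i) + (\<Prod>i\<in>S. r i) \<le> (\<Prod>i\<in>S. M i)"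
    and "i \<in> S \<Longrightarrow> c * q i ^ n + r i ^ n < M i ^ n \<Longrightarrow>
      c * (\<Prod>i\<in>S. q i) + (\<Prod>i\<in>S. r i) < (\<Prod>i\<in>S. M i)"
proof -
  have root: "(z ^ n) powr (1 / n) = z" if "z > 0" for z :: real
    using that assms(3) by (simp add: powr_realpow[symmetric] powr_powr)
  define N where "N = (\<lambda>i. (c * q i ^ n + r i ^ n) powr (1 / n))"
  have "(\<Prod>i\<in>S. c powr (1 / n)) = c"
    using assms(2,3,4) by (simp add: powr_realpow[symmetric] powr_powr)
  then have "(\<Prod>i\<in>S. (c * q i ^ n) powr (1 / n)) = c * (\<Prod>i\<in>S. q i)"
    using assms(4,5) by (simp add: powr_mult root prod.distrib)
  moreover have "(\<Prod>i\<in>S. (r i ^ n) powr (1 / n)) = (\<Prod>i\<in>S. r i)"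
    using assms(6) by (simp add: root)
  moreover have "(\<Prod>i\<in>S. (c * q i ^ n) powr (1 / n)) + (\<Prod>i\<in>S. (r i ^ n) powr (1 / n)) \<le> prod N S"
    unfolding N_def using assms by (intro holder_prod(1)) auto
  ultimately have H: "c * (\<Prod>i\<in>S. q i) + (\<Prod>i\<in>S. r i) \<le> prod N S" by simp
  have N: "0 < N i" "N i \<le> M i" if "i \<in> S" for i
  proof -
    have s: "c * q i ^ n + r i ^ n > 0" using assms(4-6) that by (simp add: add_pos_pos)
    then show "0 < N i" by (simp add: N_def)
    have "N i \<le> (M i ^ n) powr (1 / n)" unfolding N_def using le[OF that] s by (intro powr_mono2) auto
    then show "N i \<le> M i" using assms(7)[OF that] by (simp add: root)
  qed
  have "prod N S \<le> prod M S" using N by (intro prod_mono) (auto intro: less_imp_le)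
  then show "c * (\<Prod>i\<in>S. q i) + (\<Prod>i\<in>S. r i) \<le> (\<Prod>i\<in>S. M i)" using H by linarith
  assume i: "i \<in> S" "c * q i ^ n + r i ^ n < M i ^ n"
  have "N i < (M i ^ n) powr (1 / n)"
    unfolding N_def using i assms(3-6) by (intro powr_less_mono2) (auto intro!: add_nonneg_nonneg simp: less_imp_le)
  then have "N i < M i" using assms(7)[OF i(1)] by (simp add: root)
  then have "prod N S < prod M S" using i N assms(1,7)
    by (intro prod_mono_strict[of i]) (auto intro: less_imp_le)
  then show "c * (\<Prod>i\<in>S. q i) + (\<Prod>i\<in>S. r i) < (\<Prod>i\<in>S. M i)" using H by linarith
qed

text \<open>
  The factors at one neighbour \<open>v\<close> of the removed vertex \<open>w\<close>, where \<open>w\<close> has degree \<open>n\<close> and \<open>S\<close> is the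
  set of the other neighbours of \<open>v\<close>: \<open>q\<close> is what \<open>v\<close> costs when it is deleted with \<open>w\<close>, \<open>r\<close> is its factor
  after \<open>w\<close> alone is deleted, which makes \<open>v\<close> isolated if \<open>S = {}\<close>, and \<open>M\<close> is its factor in the original
  graph. Hoelder over \<open>S\<close> distributes the factor of the edge \<open>wv\<close> evenly among the elements of \<open>S\<close> and
  leaves the inequality for two degrees at each of them. For \<open>S = {}\<close> both sides agree.
\<close>

lemma star_inequality:
  fixes x y :: real and f :: "'b \<Rightarrow> nat"
  assumes "0 < x" "0 < y" "finite S" and f: "\<And>u. u \<in> S \<Longrightarrow> 0 < f u \<and> f u \<le> n" and "0 < n"
  defines "q \<equiv> \<Prod>u\<in>S. (1 + x) powr (1 / f u)"
    and "r \<equiv> if S = {} then 1 + y else \<Prod>u\<in>S. edge_factor x y (f u) (card S)"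
    and "M \<equiv> edge_factor x y n (Suc (card S)) * (\<Prod>u\<in>S. edge_factor x y (f u) (Suc (card S)))"
  shows "x * q ^ n + r ^ n \<le> M ^ n"
    and "u \<in> S \<Longrightarrow> f u < n \<Longrightarrow> x * q ^ n + r ^ n < M ^ n"
proof -
  define m where "m = card S"
  define C where "C = (\<lambda>u. (biclique_poly x y n (Suc m) powr (1 / Suc m)
      * biclique_poly x y (f u) (Suc m) powr (real n / f u * (m / Suc m))) powr (1 / m))"
  define Q where "Q = (\<lambda>u. (1 + x) powr (real n / f u))"
  define R where "R = (\<lambda>u. edge_factor x y (f u) m ^ n)"
  have Kpos: "biclique_poly x y a b > 0" for a b using biclique_poly_pos assms(1,2) .
  have pow: "(z powr s) ^ n = z powr (s * n)" if "z > 0" for z s :: real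
    using that by (simp add: powr_powr flip: powr_realpow)
  have empty: "x * q ^ n + r ^ n = M ^ n" if "S = {}"
    using that assms(5) Kpos[of n 1]
    by (simp add: q_def r_def M_def edge_factor_def pow) (simp add: biclique_poly_def)
  {
    assume ne: "S \<noteq> {}"
    then have m: "m > 0" using assms(3) by (simp add: m_def card_gt_0_iff)
    have rootpow: "(z powr (1 / m)) ^ m = z" if "z > 0" for z :: real
      using that m by (simp add: powr_powr flip: powr_realpow)
    have q: "q ^ n = prod Q S"
      using assms(1) by (simp add: q_def Q_def prod_power_distrib pow)
    have r: "r ^ n = prod R S"
      using ne by (simp add: r_def R_def prod_power_distrib m_def)
    have expo: "real m / (real m + real m * real m) = 1 / (1 + real m)"
    proof -
      have "real m + real m * real m = real m * (1 + real m)" by (simp add: algebra_simps)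
      then show ?thesis using m by simp
    qed
    have "prod C S = (\<Prod>u\<in>S. biclique_poly x y n (Suc m) powr (1 / (Suc m * m)))
       * (\<Prod>u\<in>S. edge_factor x y (f u) (Suc m) ^ n)"
      unfolding prod.distrib[symmetric] C_def using m
      by (intro prod.cong refl) (simp add: powr_mult powr_powr edge_factor_def pow Kpos field_simps)
    also have "(\<Prod>u\<in>S. biclique_poly x y n (Suc m) powr (1 / (Suc m * m)))
        = edge_factor x y n (Suc m) ^ n"
      using m assms(5) Kpos[of n "Suc m"]
      by (simp add: m_def[symmetric] edge_factor_def pow powr_powr expo flip: powr_realpow)
    finally have C: "prod C S = M ^ n"
      by (simp add: M_def m_def power_mult_distrib prod_power_distrib)
    have Q': "Q u ^ m = (1 + x) powr (real n / f u * m)" for u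
      using assms(1) by (simp add: Q_def powr_powr flip: powr_realpow)
    have R': "R u ^ m = biclique_poly x y (f u) m powr (real n / f u)" for u
      using m Kpos[of "f u" m] by (simp add: R_def edge_factor_def pow powr_powr flip: powr_realpow)
    have C': "C u ^ m = biclique_poly x y n (Suc m) powr (1 / Suc m)
      * biclique_poly x y (f u) (Suc m) powr (real n / f u * (m / Suc m))" for u
      unfolding C_def using Kpos[of n "Suc m"] Kpos[of "f u" "Suc m"] by (intro rootpow) auto
    have Cpos: "C u > 0" for u using Kpos[of n "Suc m"] Kpos[of "f u" "Suc m"] by (simp add: C_def)
    have Qpos: "Q u > 0" for u using assms(1) by (simp add: Q_def)
    have Rpos: "R u > 0" for u using edge_factor_pos[OF assms(1,2)] by (simp add: R_def)
    have le: "x * Q u ^ m + R u ^ m \<le> C u ^ m" if "u \<in> S" for u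
      unfolding Q' R' C' using two_degree_inequality_le assms(1,2) f[OF that] m by blast
    have "x * q ^ n + r ^ n \<le> M ^ n"
      unfolding q r C[symmetric]
      by (rule holder_equal_weights(1)[of S m]) (use assms(1,3) m m_def Qpos Rpos Cpos le in auto)
    moreover have "x * q ^ n + r ^ n < M ^ n" if u: "u \<in> S" "f u < n" for u
    proof -
      have "x * Q u ^ m + R u ^ m < C u ^ m"
        unfolding Q' R' C' using two_degree_inequality assms(1,2) f[OF u(1)] m u(2) by blast
      then show ?thesis
        unfolding q r C[symmetric]
        by (intro holder_equal_weights(2)[of S m x Q R C u])
          (use assms(1,3) m m_def Qpos Rpos Cpos le u in auto)
    qed
    note calculation this
  } note nonempty = this
  show "x * q ^ n + r ^ n \<le> M ^ n" using empty nonempty(1) by fastforce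
  show "u \<in> S \<Longrightarrow> f u < n \<Longrightarrow> x * q ^ n + r ^ n < M ^ n" using nonempty(2) by blast
qed

section \<open>The bound as a product over vertices\<close>

lemma degree_left:
  assumes "bigraph A B E" "u \<in> A"
  shows "degree E u = card (E `` {u})"
  unfolding degree_def by (rule arg_cong[of _ _ card]) (use assms in \<open>auto simp: bigraph_def\<close>)

lemma degree_right:
  assumes "bigraph A B E" "v \<in> B"
  shows "degree E v = card (E\<inverse> `` {v})"
  unfolding degree_def by (rule arg_cong[of _ _ card]) (use assms in \<open>auto simp: bigraph_def\<close>)

lemma bigraph_finite:
  assumes "bigraph A B E"
  shows "finite A" "finite B" "finite E" "finite (E `` S)" "finite (E\<inverse> `` S)"
proof -
  show fin: "finite A" "finite B" using assms by (auto simp: bigraph_def)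
  have sub: "E \<subseteq> A \<times> B" using assms by (simp add: bigraph_def)
  then show "finite E" using fin by (meson finite_SigmaI finite_subset)
  show "finite (E `` S)" "finite (E\<inverse> `` S)"
    using sub fin by (auto intro: finite_subset[of _ B] finite_subset[of _ A])
qed

lemma isolated_left: "bigraph A B E \<Longrightarrow> u \<in> A \<Longrightarrow> isolated E u \<longleftrightarrow> E `` {u} = {}"
  using bigraph_finite(4)[of A B E "{u}"] by (simp add: isolated_def degree_left)

lemma isolated_right: "bigraph A B E \<Longrightarrow> v \<in> B \<Longrightarrow> isolated E v \<longleftrightarrow> E\<inverse> `` {v} = {}"
  using bigraph_finite(5)[of A B E "{v}"] by (simp add: isolated_def degree_right)

text \<open>
  The bound extended to bigraphs with isolated vertices, which arise in the induction.
\<close>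

definition degree_bound :: "'a set \<Rightarrow> 'a set \<Rightarrow> ('a \<times> 'a) set \<Rightarrow> real \<Rightarrow> real \<Rightarrow> real" where
  "degree_bound A B E x y =
    (\<Prod>(u, v)\<in>E. edge_factor x y (degree E u) (degree E v))
    * (1 + x) ^ card {u \<in> A. isolated E u} * (1 + y) ^ card {v \<in> B. isolated E v}"

lemma prod_if_power: "finite S \<Longrightarrow> (\<Prod>i\<in>S. if P i then c else 1) = (c::real) ^ card {i \<in> S. P i}"
  by (simp add: prod.If_cases Int_def)

text \<open>
  Grouping the edges by their left ends suits the deletion of right vertices, which changes left degrees only;
  grouping by right ends suits the deletion of a left vertex.
\<close>

lemma degree_bound_by_left:
  assumes "bigraph A B E"
  shows "degree_bound A B E x y =
    (\<Prod>u\<in>A. if E `` {u} = {} then 1 + x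
        else \<Prod>v\<in>E `` {u}. edge_factor x y (card (E `` {u})) (card (E\<inverse> `` {v})))
    * (\<Prod>v\<in>B. if E\<inverse> `` {v} = {} then 1 + y else 1)"
proof -
  note fin = bigraph_finite[OF assms]
  have sub: "E \<subseteq> A \<times> B" using assms by (simp add: bigraph_def)
  have "(\<Prod>(u, v)\<in>E. edge_factor x y (degree E u) (degree E v))
      = (\<Prod>(u, v)\<in>Sigma A (\<lambda>u. E `` {u}). edge_factor x y (card (E `` {u})) (card (E\<inverse> `` {v})))"
    using sub by (intro prod.cong) (auto simp: degree_left[OF assms] degree_right[OF assms])
  also have "\<dots> = (\<Prod>u\<in>A. \<Prod>v\<in>E `` {u}. edge_factor x y (card (E `` {u})) (card (E\<inverse> `` {v})))"
    using fin by (subst prod.Sigma) auto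
  finally have edges: "(\<Prod>(u, v)\<in>E. edge_factor x y (degree E u) (degree E v)) = \<dots>" .
  have "(1 + x) ^ card {u \<in> A. isolated E u} = (\<Prod>u\<in>A. if E `` {u} = {} then 1 + x else 1)"
    unfolding prod_if_power[OF fin(1)]
    by (rule arg_cong[of _ _ "\<lambda>S. _ ^ card S"]) (use isolated_left[OF assms] in auto)
  moreover have "(1 + y) ^ card {v \<in> B. isolated E v} = (\<Prod>v\<in>B. if E\<inverse> `` {v} = {} then 1 + y else 1)"
    unfolding prod_if_power[OF fin(2)]
    by (rule arg_cong[of _ _ "\<lambda>S. _ ^ card S"]) (use isolated_right[OF assms] in auto)
  ultimately show ?thesis
    unfolding degree_bound_def edges
    by (auto simp: prod.distrib[symmetric] intro!: prod.cong)
qed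

lemma degree_bound_by_right:
  assumes "bigraph A B E"
  shows "degree_bound A B E x y =
    (\<Prod>u\<in>A. if E `` {u} = {} then 1 + x else 1)
    * (\<Prod>v\<in>B. if E\<inverse> `` {v} = {} then 1 + y
        else \<Prod>u\<in>E\<inverse> `` {v}. edge_factor x y (card (E `` {u})) (card (E\<inverse> `` {v})))"
proof -
  note fin = bigraph_finite[OF assms]
  have sub: "E \<subseteq> A \<times> B" using assms by (simp add: bigraph_def)
  define g where "g = (\<lambda>u v. edge_factor x y (card (E `` {u})) (card (E\<inverse> `` {v})))"
  have "(\<Prod>u\<in>A. \<Prod>v\<in>{v\<in>B. (u, v) \<in> E}. g u v) = (\<Prod>v\<in>B. \<Prod>u\<in>{u\<in>A. (u, v) \<in> E}. g u v)"
    using fin by (intro prod.swap_restrict) auto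
  moreover have "{v\<in>B. (u, v) \<in> E} = E `` {u}" "{u\<in>A. (u, v) \<in> E} = E\<inverse> `` {v}" for u v
    using sub by auto
  ultimately have swap: "(\<Prod>u\<in>A. \<Prod>v\<in>E `` {u}. g u v) = (\<Prod>v\<in>B. \<Prod>u\<in>E\<inverse> `` {v}. g u v)"
    by simp
  have left: "(\<Prod>u\<in>A. if E `` {u} = {} then 1 + x else \<Prod>v\<in>E `` {u}. g u v)
      = (\<Prod>u\<in>A. if E `` {u} = {} then 1 + x else 1) * (\<Prod>u\<in>A. \<Prod>v\<in>E `` {u}. g u v)"
    unfolding prod.distrib[symmetric] by (intro prod.cong) auto
  have right: "(\<Prod>v\<in>B. if E\<inverse> `` {v} = {} then 1 + y else \<Prod>u\<in>E\<inverse> `` {v}. g u v)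
      = (\<Prod>v\<in>B. if E\<inverse> `` {v} = {} then 1 + y else 1) * (\<Prod>v\<in>B. \<Prod>u\<in>E\<inverse> `` {v}. g u v)"
    unfolding prod.distrib[symmetric] by (intro prod.cong) auto
  show ?thesis
    unfolding degree_bound_by_left[OF assms] left[unfolded g_def] right[unfolded g_def] swap[unfolded g_def]
    by (simp only: mult_ac)
qed

section \<open>Recursion for the independent set polynomial\<close>

lemma finite_independent_sets: "bigraph A B E \<Longrightarrow> finite (independent_sets A B E)"
  by (rule finite_subset[of _ "Pow (A \<union> B)"]) (auto simp: independent_sets_def bigraph_def)

lemma indep_poly_remove_left_vertex:
  assumes "bigraph A B E" "w \<in> A"
  shows "indep_poly A B E x y
    = indep_poly (A - {w}) B {(u, v) \<in> E. u \<noteq> w} x y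
      + x * indep_poly (A - {w}) (B - E `` {w}) {(u, v) \<in> E. v \<notin> E `` {w}} x y"
proof -
  define V where "V = E `` {w}"
  define I1 where "I1 = independent_sets (A - {w}) B {(u, v) \<in> E. u \<noteq> w}"
  define I2 where "I2 = independent_sets (A - {w}) (B - V) {(u, v) \<in> E. v \<notin> V}"
  have AB: "A \<inter> B = {}" "E \<subseteq> A \<times> B" and fin: "finite A" "finite B"
    using assms(1) by (auto simp: bigraph_def)
  have wB: "w \<notin> B" using AB(1) assms(2) by auto
  have no_w: "w \<notin> I" if "I \<in> I2 \<or> I \<in> I1" for I
    using that AB assms(2) by (auto simp: I1_def I2_def independent_sets_def)
  have split: "independent_sets A B E = I1 \<union> insert w ` I2"
  proof (intro equalityI subsetI)
    fix I assume I: "I \<in> independent_sets A B E"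
    show "I \<in> I1 \<union> insert w ` I2"
    proof (cases "w \<in> I")
      case True
      have "I - {w} \<in> I2"
        using I True by (auto simp: I2_def V_def independent_sets_def)
      then show ?thesis using True by (auto intro!: image_eqI[of _ _ "I - {w}"])
    next
      case False
      then show ?thesis using I by (auto simp: I1_def independent_sets_def)
    qed
  next
    fix I assume "I \<in> I1 \<union> insert w ` I2"
    then show "I \<in> independent_sets A B E"
    proof
      assume "I \<in> I1"
      then show ?thesis using no_w[of I] by (auto simp: I1_def independent_sets_def)
    next
      assume "I \<in> insert w ` I2"
      then obtain J where J: "J \<in> I2" "I = insert w J" by auto
      then have J': "J \<subseteq> (A - {w}) \<union> (B - V)" "\<And>u v. u \<in> J \<Longrightarrow> v \<in> J \<Longrightarrow> (u, v) \<in> E \<Longrightarrow> v \<in> V"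
        by (auto simp: I2_def independent_sets_def)
      have "V \<subseteq> B" using AB(2) by (auto simp: V_def)
      then have JV: "J \<inter> V = {}" using J'(1) AB(1) by auto
      have "(u, v) \<notin> E" if uv: "u \<in> I" "v \<in> I" for u v
      proof
        assume e: "(u, v) \<in> E"
        then have "v \<in> J" using uv(2) J(2) AB(2) wB by auto
        moreover have "v \<in> V" using e uv(1) J'(2)[OF _ \<open>v \<in> J\<close>] J(2) by (auto simp: V_def)
        ultimately show False using JV by auto
      qed
      moreover have "I \<subseteq> A \<union> B" using J(2) J'(1) assms(2) by auto
      ultimately show ?thesis by (auto simp: independent_sets_def)
    qed
  qed
  have fin12: "finite I1" "finite I2"
    unfolding I1_def I2_def
    by (rule finite_independent_sets; use assms(1) in \<open>auto simp: bigraph_def V_def\<close>)+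
  have disj: "I1 \<inter> insert w ` I2 = {}" using no_w by auto
  have inj: "inj_on (insert w) I2" using no_w by (metis (no_types) inj_onI insert_ident)
  have w1: "I \<inter> A = I \<inter> (A - {w})" if "I \<in> I1" for I using no_w that by auto
  have w2: "card (insert w I \<inter> A) = Suc (card (I \<inter> (A - {w})))"
      "insert w I \<inter> B = I \<inter> (B - V)" if "I \<in> I2" for I
  proof -
    have "insert w I \<inter> A = insert w (I \<inter> (A - {w}))" using assms(2) by auto
    then show "card (insert w I \<inter> A) = Suc (card (I \<inter> (A - {w})))" using fin by simp
    have "I \<subseteq> (A - {w}) \<union> (B - V)" using that by (auto simp: I2_def independent_sets_def)
    then show "insert w I \<inter> B = I \<inter> (B - V)" using AB(1) wB by auto
  qed
  have "indep_poly A B E x y = (\<Sum>I\<in>I1. x ^ card (I \<inter> A) * y ^ card (I \<inter> B))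
      + (\<Sum>I\<in>insert w ` I2. x ^ card (I \<inter> A) * y ^ card (I \<inter> B))"
    unfolding indep_poly_def split using fin12 disj by (intro sum.union_disjoint) auto
  also have "(\<Sum>I\<in>I1. x ^ card (I \<inter> A) * y ^ card (I \<inter> B))
      = (\<Sum>I\<in>I1. x ^ card (I \<inter> (A - {w})) * y ^ card (I \<inter> B))"
    using w1 by (intro sum.cong) auto
  also have "(\<Sum>I\<in>insert w ` I2. x ^ card (I \<inter> A) * y ^ card (I \<inter> B))
      = x * (\<Sum>I\<in>I2. x ^ card (I \<inter> (A - {w})) * y ^ card (I \<inter> (B - V)))"
    by (simp add: sum.reindex[OF inj] sum_distrib_left w2 mult.assoc)
  finally show ?thesis by (simp add: indep_poly_def I1_def I2_def V_def)
qed

lemma indep_poly_no_edges: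
  assumes "finite A" "finite B" "A \<inter> B = {}"
  shows "indep_poly A B {} x y = (1 + x) ^ card A * (1 + y) ^ card B"
proof -
  define c where "c = (\<lambda>v. if v \<in> A then x else y)"
  have "indep_poly A B {} x y = (\<Sum>I\<in>Pow (A \<union> B). (\<Prod>v\<in>I. c v) * (\<Prod>v\<in>(A \<union> B) - I. 1))"
    unfolding indep_poly_def
  proof (intro sum.cong)
    fix I assume "I \<in> Pow (A \<union> B)"
    then have "I = (I \<inter> A) \<union> (I \<inter> B)" by auto
    then have "prod c I = prod c (I \<inter> A) * prod c (I \<inter> B)"
      using assms by (metis (no_types, lifting) finite_Int inf_assoc inf_bot_right inf_commute prod.union_disjoint)
    also have "prod c (I \<inter> A) = x ^ card (I \<inter> A)" by (simp add: c_def)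
    also have "prod c (I \<inter> B) = (\<Prod>v\<in>I \<inter> B. y)"
      using assms(3) by (intro prod.cong) (auto simp: c_def)
    finally show "x ^ card (I \<inter> A) * y ^ card (I \<inter> B) = (\<Prod>v\<in>I. c v) * (\<Prod>v\<in>(A \<union> B) - I. 1)"
      by simp
  qed (auto simp: independent_sets_def)
  also have "\<dots> = (\<Prod>v\<in>A \<union> B. c v + 1)" using assms by (subst prod_add) auto
  also have "\<dots> = (\<Prod>v\<in>A. c v + 1) * (\<Prod>v\<in>B. c v + 1)" using assms by (intro prod.union_disjoint)
  also have "(\<Prod>v\<in>A. c v + 1) = (1 + x) ^ card A" by (simp add: c_def add.commute)
  also have "(\<Prod>v\<in>B. c v + 1) = (\<Prod>v\<in>B. 1 + y)"
    using assms(3) by (intro prod.cong) (auto simp: c_def)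
  finally show ?thesis by simp
qed

section \<open>The induction\<close>

text \<open>
  For bigraphs this says that every component that has an edge is complete bipartite.
\<close>

definition neighbourhoods_equal_or_disjoint :: "('a \<times> 'a) set \<Rightarrow> bool" where
  "neighbourhoods_equal_or_disjoint E \<longleftrightarrow>
    (\<forall>u u'. E `` {u} \<inter> E `` {u'} \<noteq> {} \<longrightarrow> E `` {u} = E `` {u'})"

text \<open>
  Compares the bound for \<open>G - w - V\<close>, with its lowered left degrees, to a product \<open>rest\<close> that uses the degrees
  of \<open>G\<close> and charges \<open>(1 + x) powr (1 / deg u)\<close> for each edge \<open>uv\<close> with \<open>u \<noteq> w\<close>, \<open>v \<in> V\<close>.
  The comparison is made at each left vertex \<open>u\<close> separately. If \<open>u\<close> loses no edge there is nothing to prove; if it loses all its edges the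
  charges multiply to \<open>1 + x\<close>, its factor as an isolated vertex; otherwise every remaining edge gains
  strictly.
\<close>

lemma degree_bound_remove_closed_neighbourhood:
  fixes x y :: real
  assumes G: "bigraph A B E" and w: "w \<in> A" and xy: "0 < x" "0 < y"
  defines "V \<equiv> E `` {w}"
  defines "bound2 \<equiv> degree_bound (A - {w}) (B - V) {(u, v) \<in> E. v \<notin> V} x y"
    and "rest \<equiv> (\<Prod>u\<in>A - {w}. if E `` {u} = {} then 1 + x else 1)
        * (\<Prod>v\<in>B - V. if E\<inverse> `` {v} = {} then 1 + y
            else \<Prod>u\<in>E\<inverse> `` {v}. edge_factor x y (card (E `` {u})) (card (E\<inverse> `` {v})))
        * (\<Prod>v\<in>V. \<Prod>u\<in>E\<inverse> `` {v} - {w}. (1 + x) powr (1 / card (E `` {u})))"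
  shows "bound2 \<le> rest"
    and "bound2 = rest \<Longrightarrow> u \<in> A - {w} \<Longrightarrow> E `` {u} \<inter> V \<noteq> {} \<Longrightarrow> E `` {u} \<subseteq> V"
proof -
  note fin = bigraph_finite[OF G]
  define E2 where "E2 = {(u, v) \<in> E. v \<notin> V}"
  have AB: "A \<inter> B = {}" "E \<subseteq> A \<times> B" using G by (auto simp: bigraph_def)
  have VB: "V \<subseteq> B" "finite V" using AB fin by (auto simp: V_def)
  have G2: "bigraph (A - {w}) (B - V) E2"
    using G by (auto simp: bigraph_def E2_def V_def)
  have left2: "E2 `` {u} = E `` {u} - V" for u by (auto simp: E2_def)
  have right2: "E2\<inverse> `` {v} = E\<inverse> `` {v}" if "v \<notin> V" for v using that by (auto simp: E2_def)
  \<comment> \<open>\<open>L u\<close> and \<open>L' u\<close> are the contributions of a left vertex \<open>u\<close> to \<open>bound2\<close> and to \<open>rest\<close>.\<close>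
  define L where "L = (\<lambda>u. if E `` {u} - V = {} then 1 + x
      else \<Prod>v\<in>E `` {u} - V. edge_factor x y (card (E `` {u} - V)) (card (E\<inverse> `` {v})))"
  define L' where "L' = (\<lambda>u. (if E `` {u} = {} then 1 + x else 1)
      * (\<Prod>v\<in>E `` {u} \<inter> V. (1 + x) powr (1 / card (E `` {u})))
      * (\<Prod>v\<in>E `` {u} - V. edge_factor x y (card (E `` {u})) (card (E\<inverse> `` {v}))))"
  define isos where "isos = (\<Prod>v\<in>B - V. if E\<inverse> `` {v} = {} then 1 + y else 1)"
  have isos: "isos > 0" unfolding isos_def using xy by (intro prod_pos) auto
  have bound2: "bound2 = prod L (A - {w}) * isos"
    unfolding bound2_def E2_def[symmetric] degree_bound_by_left[OF G2] left2 L_def isos_def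
    by (intro arg_cong2[of _ _ _ _ "(*)"] prod.cong if_cong refl) (auto simp: right2)
  have rest: "rest = prod L' (A - {w}) * isos"
  proof -
    define g where "g = (\<lambda>u v. edge_factor x y (card (E `` {u})) (card (E\<inverse> `` {v})))"
    have "(\<Prod>u\<in>A - {w}. \<Prod>v\<in>{v\<in>V. (u, v) \<in> E}. (1 + x) powr (1 / card (E `` {u})))
        = (\<Prod>v\<in>V. \<Prod>u\<in>{u\<in>A - {w}. (u, v) \<in> E}. (1 + x) powr (1 / card (E `` {u})))"
      using fin VB by (intro prod.swap_restrict) auto
    moreover have "{v\<in>V. (u, v) \<in> E} = E `` {u} \<inter> V" "{u\<in>A - {w}. (u, v) \<in> E} = E\<inverse> `` {v} - {w}" for u v
      using AB by auto
    ultimately have inner: "(\<Prod>u\<in>A - {w}. \<Prod>v\<in>E `` {u} \<inter> V. (1 + x) powr (1 / card (E `` {u})))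
        = (\<Prod>v\<in>V. \<Prod>u\<in>E\<inverse> `` {v} - {w}. (1 + x) powr (1 / card (E `` {u})))" by simp
    have "(\<Prod>u\<in>A - {w}. \<Prod>v\<in>{v\<in>B - V. (u, v) \<in> E}. g u v)
        = (\<Prod>v\<in>B - V. \<Prod>u\<in>{u\<in>A - {w}. (u, v) \<in> E}. g u v)"
      using fin by (intro prod.swap_restrict) auto
    also have "\<dots> = (\<Prod>v\<in>B - V. \<Prod>u\<in>E\<inverse> `` {v}. g u v)"
      using AB by (intro prod.cong) (auto simp: V_def)
    also have "(\<Prod>u\<in>A - {w}. \<Prod>v\<in>{v\<in>B - V. (u, v) \<in> E}. g u v)
        = (\<Prod>u\<in>A - {w}. \<Prod>v\<in>E `` {u} - V. g u v)"
      using AB by (intro prod.cong) auto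
    finally have outer: "(\<Prod>u\<in>A - {w}. \<Prod>v\<in>E `` {u} - V. g u v)
        = (\<Prod>v\<in>B - V. \<Prod>u\<in>E\<inverse> `` {v}. g u v)" .
    have "(\<Prod>v\<in>B - V. if E\<inverse> `` {v} = {} then 1 + y else \<Prod>u\<in>E\<inverse> `` {v}. g u v)
        = isos * (\<Prod>v\<in>B - V. \<Prod>u\<in>E\<inverse> `` {v}. g u v)"
      unfolding isos_def prod.distrib[symmetric] by (intro prod.cong) auto
    then show ?thesis
      unfolding rest_def L'_def prod.distrib inner outer[unfolded g_def] g_def by (simp only: mult_ac)
  qed
  have Lpos: "L u > 0" for u
    unfolding L_def using xy edge_factor_pos[OF xy] by (auto intro!: prod_pos)
  have L_eq: "L u = L' u" if "E `` {u} \<inter> V = {} \<or> E `` {u} \<subseteq> V" for u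
  proof (cases "E `` {u} \<inter> V = {}")
    case True
    then have off: "E `` {u} - V = E `` {u}" by auto
    show ?thesis unfolding L_def L'_def True off by simp
  next
    case False
    then have sets: "E `` {u} - V = {}" "E `` {u} \<inter> V = E `` {u}" and ne: "E `` {u} \<noteq> {}"
      using that by auto
    then have "card (E `` {u}) > 0" using fin by (simp add: card_gt_0_iff)
    then show ?thesis
      unfolding L_def L'_def sets using ne xy by (simp add: powr_powr flip: powr_realpow)
  qed
  have L_less: "L u < L' u" if "E `` {u} \<inter> V \<noteq> {}" "\<not> E `` {u} \<subseteq> V" for u
  proof -
    define m d where "m = card (E `` {u} - V)" and "d = card (E `` {u})"
    have finu: "finite (E `` {u})" using fin by auto
    have "m > 0" using that finu by (auto simp: m_def card_gt_0_iff)
    moreover have "m < d" unfolding m_def d_def using that finu by (intro psubset_card_mono) auto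
    ultimately have md: "0 < m" "m < d" .
    have dm: "d = m + card (E `` {u} \<inter> V)"
      unfolding m_def d_def using finu by (subst card_Un_disjoint[symmetric]) (auto intro: arg_cong[of _ _ card])
    have "L u = (\<Prod>v\<in>E `` {u} - V. edge_factor x y m (card (E\<inverse> `` {v})))"
      using that by (auto simp: L_def m_def)
    also have "\<dots> < (\<Prod>v\<in>E `` {u} - V. (1 + x) powr ((1 - m / d) / m) * edge_factor x y d (card (E\<inverse> `` {v})))"
    proof -
      have less: "edge_factor x y m (card (E\<inverse> `` {v}))
          < (1 + x) powr ((1 - m / d) / m) * edge_factor x y d (card (E\<inverse> `` {v}))"
        if "v \<in> E `` {u} - V" for v
        using that fin md xy by (intro edge_factor_less_increase_left) (auto simp: card_gt_0_iff)
      obtain v where "v \<in> E `` {u} - V" using \<open>\<not> E `` {u} \<subseteq> V\<close> by auto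
      then show ?thesis
        using less finu xy edge_factor_pos[OF xy]
        by (intro prod_mono_strict[of v]) (auto intro!: less_imp_le mult_pos_pos)
    qed
    also have "\<dots> = (1 + x) powr ((1 - m / d) / m * m)
        * (\<Prod>v\<in>E `` {u} - V. edge_factor x y d (card (E\<inverse> `` {v})))"
      using xy by (simp add: prod.distrib m_def powr_powr flip: powr_realpow)
    also have "(1 - m / d) / m * m = card (E `` {u} \<inter> V) / d"
    proof -
      have "(1 - m / d) / m * m = (real d - m) / d" using md by (simp add: diff_divide_distrib left_diff_distrib)
      then show ?thesis using dm by simp
    qed
    also have "(1 + x) powr (card (E `` {u} \<inter> V) / d) = (\<Prod>v\<in>E `` {u} \<inter> V. (1 + x) powr (1 / d))"
      using xy by (simp add: powr_powr flip: powr_realpow)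
    also have "\<dots> * (\<Prod>v\<in>E `` {u} - V. edge_factor x y d (card (E\<inverse> `` {v}))) = L' u"
      using that by (auto simp: L'_def d_def)
    finally show ?thesis .
  qed
  have L_le: "L u \<le> L' u" for u using L_eq[of u] L_less[of u] by fastforce
  have "prod L (A - {w}) \<le> prod L' (A - {w})"
    using Lpos L_le by (intro prod_mono) (auto intro: less_imp_le)
  then show "bound2 \<le> rest" unfolding bound2 rest using isos by simp
  show "E `` {u} \<subseteq> V" if eq: "bound2 = rest" and u: "u \<in> A - {w}" and meet: "E `` {u} \<inter> V \<noteq> {}"
  proof (rule ccontr)
    assume "\<not> E `` {u} \<subseteq> V"
    then have "L u \<noteq> L' u" using L_less meet by fastforce
    moreover have "prod L (A - {w}) = prod L' (A - {w})" using eq isos unfolding bound2 rest by simp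
    then have "L u = L' u" using Lpos L_le fin(1) u by (intro prod_mono_eq[of "A - {w}" L L']) simp_all
    ultimately show False by simp
  qed
qed

text \<open>
  The factors at right vertices outside \<open>E `` {w}\<close> are common to the bounds for \<open>G\<close> and \<open>G - w\<close>, and cancel.
\<close>

lemma degree_bound_remove_vertex:
  fixes x y :: real
  assumes G: "bigraph A B E" and w: "w \<in> A" "E `` {w} \<noteq> {}"
  defines "isos \<equiv> \<Prod>u\<in>A - {w}. if E `` {u} = {} then 1 + x else 1"
    and "far \<equiv> \<Prod>v\<in>B - E `` {w}. if E\<inverse> `` {v} = {} then 1 + y
          else \<Prod>u\<in>E\<inverse> `` {v}. edge_factor x y (card (E `` {u})) (card (E\<inverse> `` {v}))"
    and "near1 \<equiv> \<Prod>v\<in>E `` {w}. if E\<inverse> `` {v} - {w} = {} then 1 + y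
          else \<Prod>u\<in>E\<inverse> `` {v} - {w}. edge_factor x y (card (E `` {u})) (card (E\<inverse> `` {v} - {w}))"
    and "near \<equiv> \<Prod>v\<in>E `` {w}. edge_factor x y (card (E `` {w})) (Suc (card (E\<inverse> `` {v} - {w})))
          * (\<Prod>u\<in>E\<inverse> `` {v} - {w}. edge_factor x y (card (E `` {u})) (Suc (card (E\<inverse> `` {v} - {w}))))"
  shows "degree_bound (A - {w}) B {(u, v) \<in> E. u \<noteq> w} x y = isos * far * near1"
    and "degree_bound A B E x y = isos * far * near"
proof -
  note fin = bigraph_finite[OF G]
  define E1 where "E1 = {(u, v) \<in> E. u \<noteq> w}"
  have G1: "bigraph (A - {w}) B E1" using G by (auto simp: bigraph_def E1_def)
  have VB: "E `` {w} \<subseteq> B" using G by (auto simp: bigraph_def)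
  have left1: "E1 `` {u} = E `` {u}" if "u \<noteq> w" for u using that by (auto simp: E1_def)
  have right1: "E1\<inverse> `` {v} = E\<inverse> `` {v} - {w}" for v by (auto simp: E1_def)
  have split: "prod h B = prod h (B - E `` {w}) * prod h (E `` {w})" for h :: "'a \<Rightarrow> real"
    using fin VB by (rule_tac prod.subset_diff) auto
  have "(\<Prod>v\<in>B. if E1\<inverse> `` {v} = {} then 1 + y
        else \<Prod>u\<in>E1\<inverse> `` {v}. edge_factor x y (card (E1 `` {u})) (card (E1\<inverse> `` {v})))
      = far * near1"
    unfolding split right1 far_def near1_def
  proof (intro arg_cong2[of _ _ _ _ "(*)"] prod.cong refl)
    fix v assume "v \<in> B - E `` {w}"
    then have v: "E\<inverse> `` {v} - {w} = E\<inverse> `` {v}" by auto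
    show "(if E\<inverse> `` {v} - {w} = {} then 1 + y
        else \<Prod>u\<in>E\<inverse> `` {v} - {w}. edge_factor x y (card (E1 `` {u})) (card (E\<inverse> `` {v} - {w})))
      = (if E\<inverse> `` {v} = {} then 1 + y
          else \<Prod>u\<in>E\<inverse> `` {v}. edge_factor x y (card (E `` {u})) (card (E\<inverse> `` {v})))"
    proof -
      have "E1 `` {u} = E `` {u}" if "u \<in> E\<inverse> `` {v}" for u using that v by (intro left1) auto
      then show ?thesis unfolding v by (intro if_cong prod.cong refl) simp
    qed
  qed (intro if_cong prod.cong refl, simp add: left1)
  moreover have "(\<Prod>u\<in>A - {w}. if E1 `` {u} = {} then 1 + x else 1) = isos"
    unfolding isos_def by (intro prod.cong) (auto simp: left1)
  ultimately show "degree_bound (A - {w}) B {(u, v) \<in> E. u \<noteq> w} x y = isos * far * near1"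
    unfolding E1_def[symmetric] degree_bound_by_right[OF G1] by (simp only: mult.assoc)
  have "(\<Prod>v\<in>E `` {w}. if E\<inverse> `` {v} = {} then 1 + y
        else \<Prod>u\<in>E\<inverse> `` {v}. edge_factor x y (card (E `` {u})) (card (E\<inverse> `` {v}))) = near"
    unfolding near_def
  proof (intro prod.cong refl)
    fix v assume "v \<in> E `` {w}"
    then have wv: "w \<in> E\<inverse> `` {v}" by auto
    then have c: "card (E\<inverse> `` {v}) = Suc (card (E\<inverse> `` {v} - {w}))"
      using fin by (intro card.remove) auto
    show "(if E\<inverse> `` {v} = {} then 1 + y
          else \<Prod>u\<in>E\<inverse> `` {v}. edge_factor x y (card (E `` {u})) (card (E\<inverse> `` {v})))
        = edge_factor x y (card (E `` {w})) (Suc (card (E\<inverse> `` {v} - {w})))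
          * (\<Prod>u\<in>E\<inverse> `` {v} - {w}. edge_factor x y (card (E `` {u})) (Suc (card (E\<inverse> `` {v} - {w}))))"
      unfolding c using wv fin prod.remove[OF fin(5) wv] by auto
  qed
  moreover have "(\<Prod>u\<in>A. if E `` {u} = {} then 1 + x else 1) = isos"
    unfolding isos_def using fin w prod.remove[OF fin(1) w(1), of "\<lambda>u. if E `` {u} = {} then 1 + x else 1"] by simp
  ultimately show "degree_bound A B E x y = isos * far * near"
    unfolding degree_bound_by_right[OF G] split far_def by (simp only: mult.assoc)
qed

text \<open>
  The bound satisfies, as an inequality, the recursion that the independent set polynomial satisfies as an
  equation. Maximality of the degree of \<open>w\<close> gives the condition \<open>deg u \<le> n\<close> of the star inequality. If
  equality holds, then every left vertex with a neighbour in \<open>V\<close> has degree \<open>n = card V\<close> and all its neighbours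
  in \<open>V\<close>.
\<close>

lemma degree_bound_recursion:
  fixes x y :: real
  assumes G: "bigraph A B E" and w: "w \<in> A" "E `` {w} \<noteq> {}" and xy: "0 < x" "0 < y"
    and max: "\<forall>u\<in>A. card (E `` {u}) \<le> card (E `` {w})"
  defines "V \<equiv> E `` {w}"
  defines "bound1 \<equiv> degree_bound (A - {w}) B {(u, v) \<in> E. u \<noteq> w} x y"
    and "bound2 \<equiv> degree_bound (A - {w}) (B - V) {(u, v) \<in> E. v \<notin> V} x y"
    and "bound \<equiv> degree_bound A B E x y"
  shows "bound1 + x * bound2 \<le> bound"
    and "bound1 + x * bound2 = bound \<Longrightarrow> E `` {u} \<inter> V \<noteq> {} \<Longrightarrow> E `` {u} = V"
proof -
  note fin = bigraph_finite[OF G]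
  define n where "n = card V"
  have VB: "V \<subseteq> B" and finV: "finite V" using G fin by (auto simp: V_def bigraph_def)
  have n: "n > 0" using w finV by (simp add: n_def V_def card_gt_0_iff)
  define S where "S = (\<lambda>v. E\<inverse> `` {v} - {w})"
  define d where "d = (\<lambda>u. card (E `` {u}))"
  define q where "q = (\<lambda>v. \<Prod>u\<in>S v. (1 + x) powr (1 / d u))"
  define r where "r = (\<lambda>v. if S v = {} then 1 + y else \<Prod>u\<in>S v. edge_factor x y (d u) (card (S v)))"
  define M where "M = (\<lambda>v. edge_factor x y n (Suc (card (S v))) * (\<Prod>u\<in>S v. edge_factor x y (d u) (Suc (card (S v)))))"
  define R where "R = (\<Prod>u\<in>A - {w}. if E `` {u} = {} then 1 + x else 1)
      * (\<Prod>v\<in>B - V. if E\<inverse> `` {v} = {} then 1 + y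
          else \<Prod>u\<in>E\<inverse> `` {v}. edge_factor x y (card (E `` {u})) (card (E\<inverse> `` {v})))"
  have ef: "edge_factor x y a b > 0" for a b using edge_factor_pos[OF xy] .
  have R: "R > 0"
    unfolding R_def using xy ef by (intro mult_pos_pos prod_pos) (auto intro!: prod_pos)
  have b1: "bound1 = R * prod r V" and b: "bound = R * prod M V"
    unfolding bound1_def bound_def degree_bound_remove_vertex[OF G w]
    unfolding R_def r_def M_def S_def d_def V_def n_def by (rule refl)+
  have b2: "bound2 \<le> R * prod q V"
    unfolding bound2_def R_def q_def S_def d_def V_def
    by (rule degree_bound_remove_closed_neighbourhood(1)[OF G w(1) xy])
  have pos: "q v > 0" "r v > 0" "M v > 0" for v
    using xy ef by (auto simp: q_def r_def M_def intro!: prod_pos mult_pos_pos)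
  have dS: "0 < d u \<and> d u \<le> n" if "u \<in> S v" for u v
  proof
    have "v \<in> E `` {u}" "u \<in> A" using that G by (auto simp: S_def bigraph_def)
    then show "0 < d u" "d u \<le> n" using fin max by (auto simp: d_def n_def V_def card_gt_0_iff)
  qed
  have finS: "finite (S v)" for v using fin by (auto simp: S_def)
  have star: "x * q v ^ n + r v ^ n \<le> M v ^ n" for v
    unfolding q_def r_def M_def by (rule star_inequality(1)[OF xy finS dS n])
  have star': "x * q v ^ n + r v ^ n < M v ^ n" if "u \<in> S v" "d u < n" for u v
    unfolding q_def r_def M_def
    by (rule star_inequality(2)[of _ _ _ d, OF xy finS _ n that]) (use dS in auto)
  have holder: "x * prod q V + prod r V \<le> prod M V"
    using pos star finV n xy by (intro holder_equal_weights(1)) (auto simp: n_def)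
  have "bound1 + x * bound2 \<le> R * (x * prod q V + prod r V)"
    using b1 mult_left_mono[OF b2, of x] xy by (simp add: algebra_simps)
  also have "\<dots> \<le> bound" unfolding b using holder R by simp
  finally show "bound1 + x * bound2 \<le> bound" .
  assume eq: "bound1 + x * bound2 = bound" and meet: "E `` {u} \<inter> V \<noteq> {}"
  have "R * (x * prod q V + prod r V) \<le> R * prod M V" using holder R by simp
  then have "x * (R * prod q V) \<le> x * bound2"
    using eq b1 b by (simp add: algebra_simps)
  then have b2': "bound2 = R * prod q V" using b2 xy by simp
  have holder': "x * prod q V + prod r V = prod M V"
    using eq R unfolding b2' b1 b by (simp add: algebra_simps flip: distrib_left) 
  show "E `` {u} = V"
  proof (cases "u = w")
    case True
    then show ?thesis by (simp add: V_def)
  next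
    case False
    obtain v where v: "v \<in> E `` {u}" "v \<in> V" using meet by auto
    then have u: "u \<in> S v" "u \<in> A" using False G by (auto simp: S_def bigraph_def)
    have "\<not> d u < n"
    proof
      assume "d u < n"
      then have "x * prod q V + prod r V < prod M V"
        using pos star finV n xy star'[OF u(1)] v(2)
        by (intro holder_equal_weights(2)[of V n x q r M v]) (auto simp: n_def)
      then show False using holder' by simp
    qed
    moreover have "E `` {u} \<subseteq> V"
      unfolding V_def
      by (rule degree_bound_remove_closed_neighbourhood(2)[OF G w(1) xy])
        (use b2' u False meet in \<open>auto simp: bound2_def R_def q_def S_def d_def V_def\<close>)
    ultimately show ?thesis using finV by (simp add: d_def n_def card_seteq)
  qed
qed

text \<open>
  In the case of equality \<open>degree_bound_recursion\<close> says that every neighbourhood which meets \<open>V\<close> is \<open>V\<close>. All others are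
  the same in \<open>G\<close> and in \<open>G - w - V\<close>, where the induction hypothesis, again in its case of equality, applies.
\<close>

lemma indep_poly_le_degree_bound:
  fixes x y :: real
  assumes "bigraph A B E" "0 < x" "0 < y"
  shows "indep_poly A B E x y \<le> degree_bound A B E x y
    \<and> (indep_poly A B E x y = degree_bound A B E x y \<longrightarrow> neighbourhoods_equal_or_disjoint E)"
  using assms(1)
proof (induction "card A" arbitrary: A B E rule: less_induct)
  case less
  note fin = bigraph_finite[OF less.prems]
  show ?case
  proof (cases "E = {}")
    case True
    have "{u \<in> A. isolated {} u} = A" "{v \<in> B. isolated {} v} = B"
      by (auto simp: isolated_def degree_def)
    then show ?thesis
      using True less.prems fin
      by (auto simp: indep_poly_no_edges degree_bound_def bigraph_def neighbourhoods_equal_or_disjoint_def)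
  next
    case False
    then obtain u0 v0 where e0: "(u0, v0) \<in> E" by auto
    then have u0: "u0 \<in> A" using less.prems by (auto simp: bigraph_def)
    have "Max ((\<lambda>u. card (E `` {u})) ` A) \<in> (\<lambda>u. card (E `` {u})) ` A"
      using fin u0 by (intro Max_in) auto
    then obtain w where w: "w \<in> A" "card (E `` {w}) = Max ((\<lambda>u. card (E `` {u})) ` A)" by auto
    have max: "\<forall>u\<in>A. card (E `` {u}) \<le> card (E `` {w})"
      unfolding w(2) using fin by (auto intro: Max_ge)
    have "card (E `` {u0}) > 0" using e0 fin by (auto simp: card_gt_0_iff)
    then have w': "E `` {w} \<noteq> {}" using max u0 by fastforce
    define V where "V = E `` {w}"
    define E1 where "E1 = {(u, v) \<in> E. u \<noteq> w}"
    define E2 where "E2 = {(u, v) \<in> E. v \<notin> V}"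
    have smaller: "card (A - {w}) < card A" using w(1) fin by (intro psubset_card_mono) auto
    have G1: "bigraph (A - {w}) B E1" and G2: "bigraph (A - {w}) (B - V) E2"
      using less.prems by (auto simp: bigraph_def E1_def E2_def V_def)
    note IH1 = less.hyps[OF smaller G1] and IH2 = less.hyps[OF smaller G2]
    note step = degree_bound_recursion[OF less.prems w(1) w' assms(2,3) max, folded V_def, folded E1_def E2_def]
    have rec: "indep_poly A B E x y
        = indep_poly (A - {w}) B E1 x y + x * indep_poly (A - {w}) (B - V) E2 x y"
      unfolding E1_def E2_def V_def by (rule indep_poly_remove_left_vertex[OF less.prems w(1)])
    have le2: "x * indep_poly (A - {w}) (B - V) E2 x y \<le> x * degree_bound (A - {w}) (B - V) E2 x y"
      using IH2 assms(2) by simp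
    have "neighbourhoods_equal_or_disjoint E" if eq: "indep_poly A B E x y = degree_bound A B E x y"
    proof -
      have "x * indep_poly (A - {w}) (B - V) E2 x y = x * degree_bound (A - {w}) (B - V) E2 x y"
        using rec eq le2 IH1 step(1) by linarith
      then have N2: "neighbourhoods_equal_or_disjoint E2" using IH2 assms(2) by simp
      have "degree_bound (A - {w}) B E1 x y + x * degree_bound (A - {w}) (B - V) E2 x y
          = degree_bound A B E x y"
        using rec eq le2 IH1 step(1) by linarith
      note component = step(2)[OF this]
      have off: "E2 `` {u} = E `` {u} - V" for u by (auto simp: E2_def)
      show ?thesis
        unfolding neighbourhoods_equal_or_disjoint_def
      proof (intro allI impI)
        fix u u' assume meet: "E `` {u} \<inter> E `` {u'} \<noteq> {}"
        show "E `` {u} = E `` {u'}"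
        proof (cases "E `` {u} \<inter> V = {} \<and> E `` {u'} \<inter> V = {}")
          case True
          then have "E2 `` {u} = E `` {u}" "E2 `` {u'} = E `` {u'}" unfolding off by auto
          then show ?thesis using N2 meet unfolding neighbourhoods_equal_or_disjoint_def by metis
        next
          case False
          then have "E `` {u} = V \<or> E `` {u'} = V" using component by auto
          then show ?thesis using component meet by (metis inf_commute)
        qed
      qed
    qed
    then show ?thesis using rec le2 IH1 step(1) by linarith
  qed
qed

section \<open>Disjoint unions of complete bipartite graphs\<close>

lemma indep_poly_complete_bipartite:
  assumes "complete_bipartite A B E"
  shows "indep_poly A B E x y = biclique_poly x y (card B) (card A)"
proof -
  have E: "E = A \<times> B" and fin: "finite A" "finite B" and AB: "A \<inter> B = {}"
    using assms by (auto simp: complete_bipartite_def bigraph_def)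
  \<comment> \<open>The empty set is counted with the subsets of \<open>A\<close>.\<close>
  have sets: "independent_sets A B E = Pow A \<union> (Pow B - {{}})"
    using AB by (auto simp: independent_sets_def E)
  have one_side: "(\<Sum>I\<in>Pow S. z ^ card I) = (1 + z) ^ card S" if "finite S" for S :: "'a set" and z :: real
    using indep_poly_no_edges[of S "{}" z 0] that
    by (simp add: indep_poly_def independent_sets_def Pow_def Int_absorb2 cong: sum.cong_simp)
  have "indep_poly A B E x y = (\<Sum>I\<in>Pow A. x ^ card (I \<inter> A) * y ^ card (I \<inter> B))
      + (\<Sum>I\<in>Pow B - {{}}. x ^ card (I \<inter> A) * y ^ card (I \<inter> B))"
    unfolding indep_poly_def sets using fin AB by (intro sum.union_disjoint) auto
  also have "(\<Sum>I\<in>Pow A. x ^ card (I \<inter> A) * y ^ card (I \<inter> B)) = (\<Sum>I\<in>Pow A. x ^ card I)"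
  proof (intro sum.cong refl)
    fix I assume "I \<in> Pow A"
    then have "I \<inter> A = I" "I \<inter> B = {}" using AB by auto
    then show "x ^ card (I \<inter> A) * y ^ card (I \<inter> B) = x ^ card I" by simp
  qed
  also have "(\<Sum>I\<in>Pow B - {{}}. x ^ card (I \<inter> A) * y ^ card (I \<inter> B)) = (\<Sum>I\<in>Pow B - {{}}. y ^ card I)"
  proof (intro sum.cong refl)
    fix I assume "I \<in> Pow B - {{}}"
    then have "I \<inter> A = {}" "I \<inter> B = I" using AB by auto
    then show "x ^ card (I \<inter> A) * y ^ card (I \<inter> B) = y ^ card I" by simp
  qed
  also have "\<dots> = (\<Sum>I\<in>Pow B. y ^ card I) - 1"
    using fin by (subst sum_diff1) auto
  finally show ?thesis using fin by (simp add: one_side biclique_poly_def)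
qed

lemma indep_poly_disjoint_union:
  assumes "bigraph A1 B1 E1" "bigraph A2 B2 E2" and disj: "(A1 \<union> B1) \<inter> (A2 \<union> B2) = {}"
  shows "indep_poly (A1 \<union> A2) (B1 \<union> B2) (E1 \<union> E2) x y = indep_poly A1 B1 E1 x y * indep_poly A2 B2 E2 x y"
proof -
  define wt where "wt = (\<lambda>(A :: 'a set) (B :: 'a set) I. x ^ card (I \<inter> A) * y ^ card (I \<inter> B) :: real)"
  have sub: "E1 \<subseteq> A1 \<times> B1" "E2 \<subseteq> A2 \<times> B2" and fin: "finite A1" "finite B1" "finite A2" "finite B2"
    using assms by (auto simp: bigraph_def)
  have "indep_poly A1 B1 E1 x y * indep_poly A2 B2 E2 x y
      = (\<Sum>(I, J)\<in>independent_sets A1 B1 E1 \<times> independent_sets A2 B2 E2. wt A1 B1 I * wt A2 B2 J)"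
    unfolding indep_poly_def wt_def sum_product by (subst sum.cartesian_product) simp
  also have "\<dots> = (\<Sum>I\<in>independent_sets (A1 \<union> A2) (B1 \<union> B2) (E1 \<union> E2). wt (A1 \<union> A2) (B1 \<union> B2) I)"
  proof (rule sum.reindex_bij_witness[where i = "\<lambda>I. (I \<inter> (A1 \<union> B1), I \<inter> (A2 \<union> B2))" and j = "\<lambda>(I, J). I \<union> J"])
    fix p assume p: "p \<in> independent_sets A1 B1 E1 \<times> independent_sets A2 B2 E2"
    obtain I J where IJ: "p = (I, J)" by (cases p)
    have I: "I \<subseteq> A1 \<union> B1" "\<And>u v. u \<in> I \<Longrightarrow> v \<in> I \<Longrightarrow> (u, v) \<notin> E1"
      and J: "J \<subseteq> A2 \<union> B2" "\<And>u v. u \<in> J \<Longrightarrow> v \<in> J \<Longrightarrow> (u, v) \<notin> E2"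
      using p IJ by (auto simp: independent_sets_def)
    have parts: "(I \<union> J) \<inter> (A1 \<union> B1) = I" "(I \<union> J) \<inter> (A2 \<union> B2) = J" using I(1) J(1) disj by auto
    then show "(\<lambda>I. (I \<inter> (A1 \<union> B1), I \<inter> (A2 \<union> B2))) ((\<lambda>(I, J). I \<union> J) p) = p" by (simp add: IJ)
    have "(u, v) \<notin> E1 \<union> E2" if "u \<in> I \<union> J" "v \<in> I \<union> J" for u v
    proof
      assume "(u, v) \<in> E1 \<union> E2"
      then show False
      proof
        assume e: "(u, v) \<in> E1"
        then have "u \<in> I" "v \<in> I" using that sub(1) parts(1) by auto
        then show False using I(2) e by auto
      next
        assume e: "(u, v) \<in> E2"
        then have "u \<in> J" "v \<in> J" using that sub(2) parts(2) by auto
        then show False using J(2) e by auto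
      qed
    qed
    then show "(\<lambda>(I, J). I \<union> J) p \<in> independent_sets (A1 \<union> A2) (B1 \<union> B2) (E1 \<union> E2)"
      using I(1) J(1) by (auto simp: IJ independent_sets_def)
    have "(I \<union> J) \<inter> (A1 \<union> A2) = (I \<inter> A1) \<union> (J \<inter> A2)" "(I \<union> J) \<inter> (B1 \<union> B2) = (I \<inter> B1) \<union> (J \<inter> B2)"
      using I(1) J(1) disj by auto
    moreover have "card ((I \<inter> A1) \<union> (J \<inter> A2)) = card (I \<inter> A1) + card (J \<inter> A2)"
      "card ((I \<inter> B1) \<union> (J \<inter> B2)) = card (I \<inter> B1) + card (J \<inter> B2)"
      using disj fin by (auto intro!: card_Un_disjoint)
    ultimately show "wt (A1 \<union> A2) (B1 \<union> B2) ((\<lambda>(I, J). I \<union> J) p) = (case p of (I, J) \<Rightarrow> wt A1 B1 I * wt A2 B2 J)"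
      by (simp add: IJ wt_def power_add)
  next
    fix I assume I: "I \<in> independent_sets (A1 \<union> A2) (B1 \<union> B2) (E1 \<union> E2)"
    then show "(\<lambda>(I, J). I \<union> J) (I \<inter> (A1 \<union> B1), I \<inter> (A2 \<union> B2)) = I"
      by (auto simp: independent_sets_def)
    show "(I \<inter> (A1 \<union> B1), I \<inter> (A2 \<union> B2)) \<in> independent_sets A1 B1 E1 \<times> independent_sets A2 B2 E2"
      using I by (auto simp: independent_sets_def)
  qed
  finally show ?thesis by (simp add: indep_poly_def wt_def)
qed

lemma indep_poly_components:
  fixes X Y :: "nat \<Rightarrow> 'a set"
  assumes "\<And>i. i < n \<Longrightarrow> complete_bipartite (X i) (Y i) (F i)"
    and "disjoint_family_on (\<lambda>i. X i \<union> Y i) {..<n}"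
  shows "bigraph (\<Union>i<n. X i) (\<Union>i<n. Y i) (\<Union>i<n. F i)
    \<and> indep_poly (\<Union>i<n. X i) (\<Union>i<n. Y i) (\<Union>i<n. F i) x y
      = (\<Prod>i<n. biclique_poly x y (card (Y i)) (card (X i)))"
  using assms
proof (induction n)
  case 0
  show ?case by (auto simp: bigraph_def indep_poly_no_edges)
next
  case (Suc n)
  have IH: "bigraph (\<Union>i<n. X i) (\<Union>i<n. Y i) (\<Union>i<n. F i)"
    "indep_poly (\<Union>i<n. X i) (\<Union>i<n. Y i) (\<Union>i<n. F i) x y
      = (\<Prod>i<n. biclique_poly x y (card (Y i)) (card (X i)))"
    using Suc.IH Suc.prems by (auto simp: disjoint_family_on_def)
  have last: "complete_bipartite (X n) (Y n) (F n)" using Suc.prems by auto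
  then have G: "bigraph (X n) (Y n) (F n)" unfolding complete_bipartite_def by blast
  have "(X i \<union> Y i) \<inter> (X n \<union> Y n) = {}" if "i < n" for i
    using Suc.prems(2) that by (auto simp: disjoint_family_on_def)
  then have disj: "(X n \<union> Y n) \<inter> ((\<Union>i<n. X i) \<union> (\<Union>i<n. Y i)) = {}" by blast
  have "bigraph (X n \<union> (\<Union>i<n. X i)) (Y n \<union> (\<Union>i<n. Y i)) (F n \<union> (\<Union>i<n. F i))"
  proof -
    define X' Y' F' where "X' = (\<Union>i<n. X i)" and "Y' = (\<Union>i<n. Y i)" and "F' = (\<Union>i<n. F i)"
    have "bigraph X' Y' F'" "(X n \<union> Y n) \<inter> (X' \<union> Y') = {}"
      using IH(1) disj by (simp_all only: X'_def Y'_def F'_def)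
    then have "bigraph (X n \<union> X') (Y n \<union> Y') (F n \<union> F')" using G by (auto simp: bigraph_def)
    then show ?thesis by (simp only: X'_def Y'_def F'_def)
  qed
  moreover have "indep_poly (X n \<union> (\<Union>i<n. X i)) (Y n \<union> (\<Union>i<n. Y i)) (F n \<union> (\<Union>i<n. F i)) x y
      = (\<Prod>i<Suc n. biclique_poly x y (card (Y i)) (card (X i)))"
    unfolding indep_poly_disjoint_union[OF G IH(1) disj] IH(2) indep_poly_complete_bipartite[OF last]
    by (simp only: prod.lessThan_Suc mult.commute)
  ultimately show ?case unfolding lessThan_Suc UN_insert by (intro conjI)
qed

text \<open>
  Each component \<open>K_{a,b}\<close> has \<open>a b\<close> edges with the same factor, whose product is its polynomial.
\<close>

lemma indep_poly_eq_if_disjoint_union: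
  fixes x y :: real
  assumes "disjoint_union_complete_bipartite A B E" and xy: "0 < x" "0 < y"
  shows "indep_poly A B E x y = (\<Prod>(u, v)\<in>E. edge_factor x y (degree E u) (degree E v))"
proof -
  obtain n :: nat and X Y F where C: "\<And>i. i < n \<Longrightarrow> complete_bipartite (X i) (Y i) (F i)"
    and disj: "disjoint_family_on (\<lambda>i. X i \<union> Y i) {..<n}"
    and union: "A = (\<Union>i<n. X i)" "B = (\<Union>i<n. Y i)" "E = (\<Union>i<n. F i)"
    using assms(1) unfolding disjoint_union_complete_bipartite_def by blast
  have P: "bigraph A B E" "indep_poly A B E x y = (\<Prod>i<n. biclique_poly x y (card (Y i)) (card (X i)))"
    using indep_poly_components[OF C disj] unfolding union by auto
  have F: "F i = X i \<times> Y i" "finite (X i)" "finite (Y i)" "X i \<noteq> {}" "Y i \<noteq> {}" if "i < n" for i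
    using C[OF that] by (auto simp: complete_bipartite_def bigraph_def)
  have apart: "(X i \<union> Y i) \<inter> (X j \<union> Y j) = {}" if "i < n" "j < n" "i \<noteq> j" for i j
    using disj that by (simp add: disjoint_family_on_def)
  have left: "degree E u = card (Y i)" if "u \<in> X i" "i < n" for u i
  proof -
    have "E `` {u} = Y i"
    proof (intro equalityI subsetI)
      fix v assume "v \<in> E `` {u}"
      then obtain j where j: "j < n" "u \<in> X j" "v \<in> Y j" using F(1) by (auto simp: union)
      then have "j = i" using apart[of i j] that by auto
      then show "v \<in> Y i" using j by simp
    next
      fix v assume "v \<in> Y i"
      then show "v \<in> E `` {u}" using that F(1) by (auto simp: union)
    qed
    moreover have "u \<in> A" using that by (auto simp: union)
    ultimately show ?thesis using degree_left[OF P(1)] by simp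
  qed
  have right: "degree E v = card (X i)" if "v \<in> Y i" "i < n" for v i
  proof -
    have "E\<inverse> `` {v} = X i"
    proof (intro equalityI subsetI)
      fix u assume "u \<in> E\<inverse> `` {v}"
      then obtain j where j: "j < n" "u \<in> X j" "v \<in> Y j" using F(1) by (auto simp: union)
      then have "j = i" using apart[of i j] that by auto
      then show "u \<in> X i" using j by simp
    next
      fix u assume "u \<in> X i"
      then show "u \<in> E\<inverse> `` {v}" using that F(1) by (auto simp: union)
    qed
    moreover have "v \<in> B" using that by (auto simp: union)
    ultimately show ?thesis using degree_right[OF P(1)] by simp
  qed
  have "(\<Prod>(u, v)\<in>E. edge_factor x y (degree E u) (degree E v))
      = (\<Prod>i<n. \<Prod>(u, v)\<in>F i. edge_factor x y (degree E u) (degree E v))"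
    unfolding union(3)
  proof (rule prod.UNION_disjoint)
    show "\<forall>i\<in>{..<n}. finite (F i)" using F by auto
    show "\<forall>i\<in>{..<n}. \<forall>j\<in>{..<n}. i \<noteq> j \<longrightarrow> F i \<inter> F j = {}" using F(1) apart by fastforce
  qed auto
  also have "\<dots> = (\<Prod>i<n. biclique_poly x y (card (Y i)) (card (X i)))"
  proof (intro prod.cong refl)
    fix i assume "i \<in> {..<n}"
    then have i: "i < n" by simp
    have "(\<Prod>(u, v)\<in>F i. edge_factor x y (degree E u) (degree E v))
        = (\<Prod>(u, v)\<in>X i \<times> Y i. edge_factor x y (card (Y i)) (card (X i)))"
      using left right F i by (intro prod.cong) auto
    also have "\<dots> = edge_factor x y (card (Y i)) (card (X i)) ^ (card (X i) * card (Y i))"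
      by (simp add: card_cartesian_product case_prod_unfold)
    also have "\<dots> = biclique_poly x y (card (Y i)) (card (X i))"
    proof -
      have "card (X i) > 0" "card (Y i) > 0" using F[OF i] by (auto simp: card_gt_0_iff)
      then show ?thesis using biclique_poly_pos[OF xy, of "card (Y i)" "card (X i)"]
          edge_factor_pos[OF xy, of "card (Y i)" "card (X i)"]
        by (simp add: edge_factor_def powr_powr mult.commute flip: powr_realpow)
    qed
    finally show "(\<Prod>(u, v)\<in>F i. edge_factor x y (degree E u) (degree E v))
      = biclique_poly x y (card (Y i)) (card (X i))" .
  qed
  finally show ?thesis using P(2) by simp
qed

text \<open>
  The components are indexed by the distinct neighbourhoods \<open>h i\<close> of left vertices; the left side of a
  component is the set of all vertices with that neighbourhood.
\<close>

lemma disjoint_union_if_neighbourhoods: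
  assumes G: "bigraph A B E" and noiso: "\<forall>v\<in>A \<union> B. \<not> isolated E v"
    and N: "neighbourhoods_equal_or_disjoint E"
  shows "disjoint_union_complete_bipartite A B E"
proof -
  note fin = bigraph_finite[OF G]
  have AB: "A \<inter> B = {}" "E \<subseteq> A \<times> B" using G by (auto simp: bigraph_def)
  obtain h where h: "bij_betw h {0..<card ((\<lambda>u. E `` {u}) ` A)} ((\<lambda>u. E `` {u}) ` A)"
    using ex_bij_betw_nat_finite[of "(\<lambda>u. E `` {u}) ` A"] fin by auto
  define n where "n = card ((\<lambda>u. E `` {u}) ` A)"
  have img: "h ` {..<n} = (\<lambda>u. E `` {u}) ` A" and inj: "inj_on h {..<n}"
    using h by (auto simp: bij_betw_def n_def atLeast0LessThan)
  define X where "X = (\<lambda>i. {u \<in> A. E `` {u} = h i})"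
  have hi: "\<exists>u\<in>A. h i = E `` {u}" if "i < n" for i using img that by blast
  have in_class: "\<exists>i<n. u \<in> X i" if "u \<in> A" for u
  proof -
    have "E `` {u} \<in> h ` {..<n}" using that img by auto
    then show ?thesis using that by (auto simp: X_def)
  qed
  have "complete_bipartite (X i) (h i) (X i \<times> h i)" if i: "i < n" for i
  proof -
    obtain u where u: "u \<in> A" "h i = E `` {u}" using hi[OF i] by auto
    have "h i \<subseteq> B" "finite (h i)" using u(2) AB(2) fin by auto
    moreover have "h i \<noteq> {}" using u noiso isolated_left[OF G u(1)] by auto
    moreover have "u \<in> X i" using u by (auto simp: X_def)
    moreover have "X i \<subseteq> A" "finite (X i)" using fin by (auto simp: X_def)
    ultimately show ?thesis using AB(1) unfolding complete_bipartite_def bigraph_def by blast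
  qed
  moreover have "disjoint_family_on (\<lambda>i. X i \<union> h i) {..<n}"
    unfolding disjoint_family_on_def
  proof (intro ballI impI)
    fix i j assume ij: "i \<in> {..<n}" "j \<in> {..<n}" "i \<noteq> j"
    then have ne: "h i \<noteq> h j" using inj by (auto simp: inj_on_def)
    obtain u u' where u: "h i = E `` {u}" "h j = E `` {u'}" using hi ij by blast
    then have "h i \<inter> h j = {}" using N ne unfolding neighbourhoods_equal_or_disjoint_def by metis
    moreover have "X i \<inter> X j = {}" using ne by (auto simp: X_def)
    moreover have "X i \<subseteq> A" "X j \<subseteq> A" "h i \<subseteq> B" "h j \<subseteq> B" using u AB(2) by (auto simp: X_def)
    ultimately show "(X i \<union> h i) \<inter> (X j \<union> h j) = {}" using AB(1) by blast
  qed
  moreover have "A = (\<Union>i<n. X i)" using in_class by (auto simp: X_def)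
  moreover have edges: "E = (\<Union>i<n. X i \<times> h i)"
  proof (intro equalityI subsetI)
    fix e assume e: "e \<in> E"
    obtain u v where uv: "e = (u, v)" by (cases e)
    then have "u \<in> A" using e AB by auto
    then obtain i where "i < n" "u \<in> X i" using in_class by blast
    then show "e \<in> (\<Union>i<n. X i \<times> h i)" using e uv by (auto simp: X_def)
  qed (auto simp: X_def)
  moreover have "B = (\<Union>i<n. h i)"
  proof (intro equalityI subsetI)
    fix v assume v: "v \<in> B"
    then have "E\<inverse> `` {v} \<noteq> {}" using noiso isolated_right[OF G] by auto
    then show "v \<in> (\<Union>i<n. h i)" using edges by auto
  next
    fix v assume "v \<in> (\<Union>i<n. h i)"
    then show "v \<in> B" using hi AB(2) by fastforce
  qed
  ultimately show ?thesis
    unfolding disjoint_union_complete_bipartite_def by (intro exI[of _ n] exI[of _ X] exI[of _ h] exI[of _ "\<lambda>i. X i \<times> h i"]) auto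
qed

theorem theorem1p6:
  fixes A B :: "'a set" and E :: "('a \<times> 'a) set" and x y :: real
  assumes "bigraph A B E"
    and "\<forall>v \<in> A \<union> B. \<not> isolated E v"
    and "x > 0" and "y > 0"
  shows "indep_poly A B E x y \<le>
           (\<Prod>(u, v)\<in>E. ((1 + x) ^ degree E v + (1 + y) ^ degree E u - 1)
              powr (1 / (real (degree E u) * real (degree E v))))
       \<and> (indep_poly A B E x y =
           (\<Prod>(u, v)\<in>E. ((1 + x) ^ degree E v + (1 + y) ^ degree E u - 1)
              powr (1 / (real (degree E u) * real (degree E v))))
          \<longleftrightarrow> disjoint_union_complete_bipartite A B E)"
proof -
  have no_isolated: "{u \<in> A. isolated E u} = {}" "{v \<in> B. isolated E v} = {}" using assms(2) by auto
  have bound: "degree_bound A B E x y = (\<Prod>(u, v)\<in>E. edge_factor x y (degree E u) (degree E v))"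
    unfolding degree_bound_def no_isolated by simp
  have le: "indep_poly A B E x y \<le> (\<Prod>(u, v)\<in>E. edge_factor x y (degree E u) (degree E v))"
    and eq: "indep_poly A B E x y = (\<Prod>(u, v)\<in>E. edge_factor x y (degree E u) (degree E v))
      \<longleftrightarrow> disjoint_union_complete_bipartite A B E"
    using indep_poly_le_degree_bound[OF assms(1,3,4)] disjoint_union_if_neighbourhoods[OF assms(1,2)]
      indep_poly_eq_if_disjoint_union[OF _ assms(3,4)]
    unfolding bound by auto
  show ?thesis
    using le eq unfolding edge_factor_def biclique_poly_def by (rule conjI)
qed

end
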